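(* Let $p\in(0,1)$, $\delta_{\text{in}},\delta_{\text{out}}>0$, $\lambda>0$, and let $(\mathbf I(n),\mathbf O(n))_{n\ge0}$ be the in- and out-degree sequences, with node sets $\mathbf V(n)$ and cumulative edge counts $M_n$, of the directed preferential attachment model with Poisson measurement. Then for $v\in\mathbf V(i)\setminus\mathbf V(i-1)$, $i\ge0$, there exist random variables $\xi_i$ and $\widetilde\xi_i$ such that, as $n\to\infty$, $$\frac{I_v(n)}{\prod_{k=0}^{n-1}\left(1+\frac{\lambda+1}{M_k+1+\delta_{\text{in}}|\mathbf V(k)|}\right)}\stackrel{\text{a.s.}}{\longrightarrow}\xi_i,\qquad \frac{O_v(n)}{\prod_{k=0}^{n-1}\left(1+\frac{(\lambda+1)(1-p)}{M_k+1+\delta_{\text{out}}|\mathbf V(k)|}\right)}\stackrel{\text{a.s.}}{\longrightarrow}\widetilde\xi_i.$$ Further, $$\prod_{k=0}^{n-1}\left(1+\frac{\lambda+1}{M_k+1+\delta_{\text{in}}|\mathbf V(k)|}\right)\asymp n^{1/(1+\delta_{\text{in}}p)},\qquad \prod_{k=0}^{n-1}\left(1+\frac{(\lambda+1)(1-p)}{M_k+1+\delta_{\text{out}}|\mathbf V(k)|}\right)\asymp n^{(1-p)/(1+\delta_{\text{out}}p)},$$ where for random $X_n$ and $a>0$, $X_n\asymp n^a$ means that (almost surely) $\limsup_{n\to\infty}X_n/n^a<\infty$ and $\limsup_{n\to\infty}n^a/X_n<\infty$.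
   Context: Notation. $\mathbb N=\{0,1,2,\dots\}$. For $v\ge1$, $\mathbf e_v$ (resp. $\widetilde{\mathbf e}_v$) is the element of $(\mathbb N^2)^\infty$ whose $v$-th entry is $(1,0)$ (resp. $(0,1)$) and whose other entries are $(0,0)$. $\{B_k\}_{k\ge1}$ are iid Bernoulli with $\mathbf P(B_k=1)=p=1-\mathbf P(B_k=0)$. $\{\tau_{k,v},\widetilde\tau_{k,v}:k,v\ge1\}$ are iid unit-rate exponential random variables. $\{\Delta M_k\}_{k\ge1}$ are iid with $\mathbf P(\Delta M_k=j)=e^{-\lambda}\lambda^{j-1}/(j-1)!$, $j\ge1$. These three families are independent. PA model with Poisson measurement. Put $M_0=0$, $M_n=\sum_{k=1}^n\Delta M_k$, and $\mathbf V(n)=\{1,\dots,1+\sum_{k=1}^{M_n}B_k\}$ (so $\mathbf V(0)=\{1\}$; $\mathbf V(-1)=\emptyset$). The process $(\mathbf I(n),\mathbf O(n))=(I_v(n),O_v(n))_{v\ge1}\in(\mathbb N^2)^\infty$ starts at $((1,1),(0,0),(0,0),\dots)$. For $n\ge0$ and $M_n+1\le k\le M_{n+1}$ put $$\mathcal J_k=\operatorname*{argmin}_{v\in\mathbf V(n)}\frac{\tau_{k,v}}{I_v(n)+\delta_{\text{in}}},\qquad \widetilde{\mathcal J}_k=\operatorname*{argmin}_{v\in\mathbf V(n)}\frac{\widetilde\tau_{k,v}}{O_v(n)+\delta_{\text{out}}},$$ $$(\mathbf I(n+1),\mathbf O(n+1))=(\mathbf I(n),\mathbf O(n))+\sum_{k=M_n+1}^{M_{n+1}}\left[\mathbf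 e_{\mathcal J_k}+(1-B_k)\widetilde{\mathbf e}_{\widetilde{\mathcal J}_k}+B_k\widetilde{\mathbf e}_{1+\sum_{j=1}^kB_j}\right].$$ Thus $\Delta M_{n+1}$ edges are added in step $n+1$ with attachment probabilities frozen at the configuration at step $n$. The nodes in $\mathbf V(i)\setminus\mathbf V(i-1)$ are those created in step $i$; the limits $\xi_i,\widetilde\xi_i$ are for a given such node $v$. *)

theory Defs
  imports "HOL-Probability.Probability"
begin

text \<open>
  All sequences are indexed from 1: the values at index 0 of the driving
  sequences and of the degree vectors are never used.
\<close>

datatype source = Coin nat | In_Clock nat nat | Out_Clock nat nat | Batch nat

text \<open>
  The law of the driving randomness. "Each of the three families is independent, and the families
  are independent of one another" is expressed as mutual independence of all the variables; the
  integer-valued ones are coerced to the reals, which does not change the sigma-algebras they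
  generate, because independence of a family of variables asks for one common value type.
\<close>

locale pa_driving = prob_space M for M :: "'a measure" +
  fixes p lam :: real
    and B :: "nat \<Rightarrow> 'a \<Rightarrow> nat"
    and \<tau> \<tau>' :: "nat \<Rightarrow> nat \<Rightarrow> 'a \<Rightarrow> real"
    and dM :: "nat \<Rightarrow> 'a \<Rightarrow> nat"
  assumes B_rv: "\<And>k. k \<ge> 1 \<Longrightarrow> random_variable (count_space UNIV) (B k)"
    and B_one: "\<And>k. k \<ge> 1 \<Longrightarrow> prob {\<omega> \<in> space M. B k \<omega> = 1} = p"
    and B_zero: "\<And>k. k \<ge> 1 \<Longrightarrow> prob {\<omega> \<in> space M. B k \<omega> = 0} = 1 - p"
    and \<tau>_exp: "\<And>k v. k \<ge> 1 \<Longrightarrow> v \<ge> 1 \<Longrightarrow> distributed M lborel (\<tau> k v) (exponential_density 1)"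
    and \<tau>'_exp: "\<And>k v. k \<ge> 1 \<Longrightarrow> v \<ge> 1 \<Longrightarrow> distributed M lborel (\<tau>' k v) (exponential_density 1)"
    and dM_rv: "\<And>k. k \<ge> 1 \<Longrightarrow> random_variable (count_space UNIV) (dM k)"
    and dM_law: "\<And>k j. k \<ge> 1 \<Longrightarrow> j \<ge> 1 \<Longrightarrow>
      prob {\<omega> \<in> space M. dM k \<omega> = j} = exp (- lam) * lam ^ (j - 1) / fact (j - 1)"
    and indep: "indep_vars (\<lambda>_. borel)
      (\<lambda>s \<omega>. case s of
          Coin k \<Rightarrow> real (B k \<omega>)
        | In_Clock k v \<Rightarrow> \<tau> k v \<omega>
        | Out_Clock k v \<Rightarrow> \<tau>' k v \<omega>
        | Batch k \<Rightarrow> real (dM k \<omega>))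
      ({Coin k |k. k \<ge> 1} \<union> {In_Clock k v |k v. k \<ge> 1 \<and> v \<ge> 1} \<union>
       {Out_Clock k v |k v. k \<ge> 1 \<and> v \<ge> 1} \<union> {Batch k |k. k \<ge> 1})"

definition edge_count :: "(nat \<Rightarrow> 'a \<Rightarrow> nat) \<Rightarrow> nat \<Rightarrow> 'a \<Rightarrow> nat" where
  "edge_count dM n \<omega> = (\<Sum>k=1..n. dM k \<omega>)"

definition nodes :: "(nat \<Rightarrow> 'a \<Rightarrow> nat) \<Rightarrow> (nat \<Rightarrow> 'a \<Rightarrow> nat) \<Rightarrow> nat \<Rightarrow> 'a \<Rightarrow> nat set" where
  "nodes B dM n \<omega> = {1..1 + (\<Sum>k=1..edge_count dM n \<omega>. B k \<omega>)}"

definition new_nodes :: "(nat \<Rightarrow> 'a \<Rightarrow> nat) \<Rightarrow> (nat \<Rightarrow> 'a \<Rightarrow> nat) \<Rightarrow> nat \<Rightarrow> 'a \<Rightarrow> nat set" where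
  "new_nodes B dM i \<omega> = nodes B dM i \<omega> - (if i = 0 then {} else nodes B dM (i - 1) \<omega>)"

text \<open>
  Ties in the argmin are resolved arbitrarily; under the law above they have probability zero.
\<close>

definition attach :: "real \<Rightarrow> (nat \<Rightarrow> nat) \<Rightarrow> nat set \<Rightarrow> (nat \<Rightarrow> real) \<Rightarrow> nat" where
  "attach \<delta> d V t = arg_min_on (\<lambda>v. t v / (real (d v) + \<delta>)) V"

primrec in_degree ::
  "real \<Rightarrow> (nat \<Rightarrow> nat \<Rightarrow> 'a \<Rightarrow> real) \<Rightarrow> (nat \<Rightarrow> 'a \<Rightarrow> nat) \<Rightarrow> (nat \<Rightarrow> 'a \<Rightarrow> nat) \<Rightarrow>
    nat \<Rightarrow> 'a \<Rightarrow> nat \<Rightarrow> nat" where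
  "in_degree \<delta> \<tau> B dM 0 \<omega> = (\<lambda>v. of_bool (v = 1))"
| "in_degree \<delta> \<tau> B dM (Suc n) \<omega> = (\<lambda>v. in_degree \<delta> \<tau> B dM n \<omega> v +
    (\<Sum>k = edge_count dM n \<omega> + 1..edge_count dM (Suc n) \<omega>.
      of_bool (v = attach \<delta> (in_degree \<delta> \<tau> B dM n \<omega>) (nodes B dM n \<omega>) (\<lambda>u. \<tau> k u \<omega>))))"

primrec out_degree ::
  "real \<Rightarrow> (nat \<Rightarrow> nat \<Rightarrow> 'a \<Rightarrow> real) \<Rightarrow> (nat \<Rightarrow> 'a \<Rightarrow> nat) \<Rightarrow> (nat \<Rightarrow> 'a \<Rightarrow> nat) \<Rightarrow>
    nat \<Rightarrow> 'a \<Rightarrow> nat \<Rightarrow> nat" where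
  "out_degree \<delta> \<tau>' B dM 0 \<omega> = (\<lambda>v. of_bool (v = 1))"
| "out_degree \<delta> \<tau>' B dM (Suc n) \<omega> = (\<lambda>v. out_degree \<delta> \<tau>' B dM n \<omega> v +
    (\<Sum>k = edge_count dM n \<omega> + 1..edge_count dM (Suc n) \<omega>.
      (1 - B k \<omega>) *
        of_bool (v = attach \<delta> (out_degree \<delta> \<tau>' B dM n \<omega>) (nodes B dM n \<omega>) (\<lambda>u. \<tau>' k u \<omega>))
      + B k \<omega> * of_bool (v = 1 + (\<Sum>j=1..k. B j \<omega>))))"

definition norm_prod ::
  "real \<Rightarrow> real \<Rightarrow> (nat \<Rightarrow> 'a \<Rightarrow> nat) \<Rightarrow> (nat \<Rightarrow> 'a \<Rightarrow> nat) \<Rightarrow> nat \<Rightarrow> 'a \<Rightarrow> real" where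
  "norm_prod c \<delta> B dM n \<omega> =
    (\<Prod>k<n. 1 + c / (real (edge_count dM k \<omega>) + 1 + \<delta> * real (card (nodes B dM k \<omega>))))"

text \<open>The limsups are taken in the extended reals, so that finiteness is not automatic.\<close>

definition as_order :: "'a measure \<Rightarrow> (nat \<Rightarrow> 'a \<Rightarrow> real) \<Rightarrow> real \<Rightarrow> bool" where
  "as_order M X a \<longleftrightarrow> (AE \<omega> in M.
     limsup (\<lambda>n. ereal (X n \<omega> / real n powr a)) < \<infinity> \<and>
     limsup (\<lambda>n. ereal (real n powr a / X n \<omega>)) < \<infinity>)"

end

theory Submission
  imports Defs
begin

text \<open>
  Given the configuration after step \<open>n\<close>, a new edge chooses \<open>v\<close> with probability proportional to
  \<open>I\<^sub>v(n) + \<delta>\<close> (competing exponential clocks), and the degrees sum to \<open>M\<^sub>n + 1\<close>. Hence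
  \<open>(I\<^sub>v(n) + \<delta>)\<close> divided by the product of the factors \<open>1 + (\<lambda> + 1) / (M\<^sub>k + 1 + \<delta> |V(k)|)\<close> is a nonnegative
  martingale from the step in which \<open>v\<close> is created, and it converges almost surely by Doob's
  upcrossing argument. For the out-degree an edge counts only if its coin is \<open>0\<close>, which
  multiplies the rate by \<open>1 - p\<close>.

  The denominators \<open>w\<^sub>k = M\<^sub>k + 1 + \<delta> |V(k)|\<close> are close to \<open>\<kappa> k\<close> with \<open>\<kappa> = (\<lambda> + 1) (1 + \<delta> p)\<close>: a second moment
  bound for \<open>M\<^sub>k\<close> and Hoeffding's inequality for the coins show that \<open>|w\<^sub>k - \<kappa> k| / k\<^sup>2\<close> is summable almost
  surely. Since \<open>w\<^sub>k \<ge> k\<close>, the logarithm of the product then differs from \<open>(c / \<kappa>) ln n\<close> by a convergent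
  sequence. In particular the product tends to infinity, so that adding \<open>\<delta>\<close> to the degree does
  not affect the limit.
\<close>

section \<open>Convergence of nonnegative supermartingales\<close>

text \<open>The obstacle is that edges are numbered across steps while the number of edges per step
  is random, so which coins and clocks have been used after step n is itself random. Conditioning is
  therefore done on single values of a countable-valued history: there every random index is a
  constant and independence of disjoint blocks of sources applies. The martingale identity is
  checked atom by atom. One parameter \<theta> lets a single locale treat both degrees. The label v
  is fixed while its creation step is random, so the martingale carries the indicator that v is
  present at step i. The shift by \<delta> makes the one-step mean proportional to the current
  value. As for \<kappa>: a batch has mean \<lambda> + 1, and each edge adds 1 to the edge count
  and, with probability p, a node of weight \<delta>. The edge count also serves as a random index
  for the coins, so the coin estimate must hold for all large indices at once; hence an exponential
  bound for the coins and only a variance for the batches.\<close>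

primrec armed :: "real \<Rightarrow> real \<Rightarrow> (nat \<Rightarrow> real) \<Rightarrow> nat \<Rightarrow> bool" where
  "armed a b x 0 \<longleftrightarrow> x 0 \<le> a"
| "armed a b x (Suc n) \<longleftrightarrow> x (Suc n) \<le> a \<or> armed a b x n \<and> x (Suc n) < b"

text \<open>Buy when the value is at most a, sell when it is at least b: \<open>armed\<close>
  records whether a unit is held. Each completed upcrossing earns at least b - a; the open position,
  bought at no more than a, is carried in the second term so that the induction closes.\<close>

lemma upcrossings_le_gain:
  assumes "a < b"
  shows "(b - a) * (\<Sum>k<n. of_bool (armed a b x k \<and> b \<le> x (Suc k)))
      + (if armed a b x n then x n - a else 0)
    \<le> (\<Sum>k<n. of_bool (armed a b x k) * (x (Suc k) - x k))"
proof (induction n)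
  case (Suc n)
  show ?case
  proof (cases "armed a b x n")
    case True
    then show ?thesis
      using Suc assms by (cases "b \<le> x (Suc n)") (auto simp: algebra_simps split: if_splits)
  next
    case False
    then show ?thesis
      using Suc assms by (auto simp: algebra_simps split: if_splits)
  qed
qed auto

text \<open>Past the last completed crossing, a visit to level a arms the sequence, and while armed
  it cannot reach b without completing another crossing.\<close>

lemma not_frequently_crossing:
  assumes "a < b" and fin: "eventually (\<lambda>k. \<not> (armed a b x k \<and> b \<le> x (Suc k))) sequentially"
  shows "\<not> (frequently (\<lambda>n. x n \<le> a) sequentially \<and> frequently (\<lambda>n. b \<le> x n) sequentially)"
proof
  assume *: "frequently (\<lambda>n. x n \<le> a) sequentially \<and> frequently (\<lambda>n. b \<le> x n) sequentially"
  obtain K where K: "\<And>k. k \<ge> K \<Longrightarrow> \<not> (armed a b x k \<and> b \<le> x (Suc k))"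
    using fin by (auto simp: eventually_sequentially)
  obtain n where n: "n \<ge> K" "x n \<le> a"
    using * by (auto simp: frequently_sequentially)
  have armed: "armed a b x m" if "m \<ge> n" for m
    using that
  proof (induction m rule: dec_induct)
    case base then show ?case using n by (cases n) auto
  next
    case (step m) then show ?case using K[of m] n by auto
  qed
  obtain m where m: "m \<ge> Suc n" "b \<le> x m"
    using * by (auto simp: frequently_sequentially)
  then obtain m' where "m = Suc m'" "m' \<ge> n" by (cases m) auto
  then show False using armed[of m'] K[of m'] m n by auto
qed

text \<open>If the lower and upper limits differed, two rationals between them would be crossed
  infinitely often. Rational levels keep the exceptional sets countable in number.\<close>

lemma convergent_if_no_crossings:
  fixes x :: "nat \<Rightarrow> real"
  assumes nonneg: "\<And>n. 0 \<le> x n"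
    and cross: "\<And>a b. a \<in> \<rat> \<Longrightarrow> b \<in> \<rat> \<Longrightarrow> 0 \<le> a \<Longrightarrow> a < b \<Longrightarrow>
      \<not> (frequently (\<lambda>n. x n \<le> a) sequentially \<and> frequently (\<lambda>n. b \<le> x n) sequentially)"
    and bdd: "frequently (\<lambda>n. x n \<le> K) sequentially"
  shows "convergent x"
proof -
  let ?y = "\<lambda>n. ereal (x n)"
  have le: "liminf ?y \<le> limsup ?y"
    by (intro Liminf_le_Limsup) simp
  have nn: "0 \<le> liminf ?y"
    by (intro Liminf_bounded) (auto simp: nonneg)
  have fin: "liminf ?y < \<infinity>"
  proof -
    have "\<not> ereal K < liminf ?y"
    proof
      assume "ereal K < liminf ?y"
      then have "eventually (\<lambda>n. \<not> x n \<le> K) sequentially"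
        using less_LiminfD by (fastforce elim: eventually_mono)
      with bdd show False by (simp add: frequently_def)
    qed
    then show ?thesis by (auto simp: not_less)
  qed
  have "\<not> liminf ?y < limsup ?y"
  proof
    assume lt: "liminf ?y < limsup ?y"
    then obtain c where c: "liminf ?y < c" "c < limsup ?y" using dense by blast
    obtain a where a: "a \<in> \<rat>" "liminf ?y < ereal a" "ereal a < c"
      using ereal_dense3[OF c(1)] by (auto simp: Rats_def)
    obtain b where b: "b \<in> \<rat>" "c < ereal b" "ereal b < limsup ?y"
      using ereal_dense3[OF c(2)] by (auto simp: Rats_def)
    have "ereal a < ereal b" using a b by (meson less_trans)
    then have ab: "a < b" by simp
    have a0: "0 \<le> a" using nn a(2) by (metis ereal_less_eq(5) less_imp_le order_trans)
    have "frequently (\<lambda>n. x n \<le> a) sequentially"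
    proof (rule ccontr)
      assume "\<not> ?thesis"
      then have "eventually (\<lambda>n. ereal a \<le> ?y n) sequentially"
        by (auto simp: not_frequently not_le elim: eventually_mono)
      then have "ereal a \<le> liminf ?y" by (rule Liminf_bounded)
      with a(2) show False by simp
    qed
    moreover have "frequently (\<lambda>n. b \<le> x n) sequentially"
    proof (rule ccontr)
      assume "\<not> ?thesis"
      then have "eventually (\<lambda>n. ?y n \<le> ereal b) sequentially"
        by (auto simp: not_frequently not_le elim: eventually_mono)
      then have "limsup ?y \<le> ereal b" by (rule Limsup_bounded)
      with b(3) show False by simp
    qed
    ultimately show False using cross[OF a(1) b(1) a0 ab] by simp
  qed
  with le have eq: "limsup ?y = liminf ?y" by simp
  then obtain l where l: "liminf ?y = ereal l"
    using fin nn by (cases "liminf ?y") auto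
  have "?y \<longlonglongrightarrow> ereal l"
    using eq l by (intro Liminf_eq_Limsup) auto
  then show ?thesis by (auto simp: convergent_def)
qed

text \<open>The supermartingale property is stated through integrals over sets of
  \<open>F n\<close>, the form in which \<open>scaled_martingale\<close> delivers it.\<close>

lemma (in prob_space) nonneg_supermartingale_convergent:
  fixes X :: "nat \<Rightarrow> 'a \<Rightarrow> real" and F :: "nat \<Rightarrow> 'a measure"
  assumes sub: "\<And>n. subalgebra M (F n)"
    and mono: "\<And>n. subalgebra (F (Suc n)) (F n)"
    and adapted: "\<And>n. X n \<in> borel_measurable (F n)"
    and nonneg: "\<And>n \<omega>. 0 \<le> X n \<omega>"
    and int: "\<And>n. integrable M (X n)"
    and super: "\<And>n A. A \<in> sets (F n) \<Longrightarrow>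
      (\<integral>\<omega>. indicator A \<omega> * X (Suc n) \<omega> \<partial>M) \<le> (\<integral>\<omega>. indicator A \<omega> * X n \<omega> \<partial>M)"
  shows "AE \<omega> in M. convergent (\<lambda>n. X n \<omega>)"
proof -
  have sp: "space (F n) = space M" for n
    using sub[of n] by (simp add: subalgebra_def)
  have setsF: "A \<in> sets (F n) \<Longrightarrow> A \<in> sets M" for A n
    using sub[of n] by (auto simp: subalgebra_def)
  have Fmono: "A \<in> sets (F n) \<Longrightarrow> A \<in> sets (F (Suc n))" for A n
    using mono[of n] by (auto simp: subalgebra_def)
  have meas[measurable]: "X n \<in> borel_measurable M" for n
    using int by auto
  have Xset: "{\<omega> \<in> space M. P (X n \<omega>)} \<in> sets (F n)" if P: "{x. P x} \<in> sets borel" for n P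
  proof -
    have "{\<omega> \<in> space M. P (X n \<omega>)} = X n -` {x. P x} \<inter> space (F n)"
      by (auto simp: sp)
    then show ?thesis using measurable_sets[OF adapted P] by simp
  qed
  have armed_sets: "{\<omega> \<in> space M. armed a b (\<lambda>n. X n \<omega>) n} \<in> sets (F n)" for a b n
  proof (induction n)
    case 0 then show ?case using Xset[of "\<lambda>x. x \<le> a" 0] by simp
  next
    case (Suc n)
    have "{\<omega> \<in> space M. armed a b (\<lambda>n. X n \<omega>) (Suc n)} =
      {\<omega> \<in> space M. X (Suc n) \<omega> \<le> a} \<union>
      ({\<omega> \<in> space M. armed a b (\<lambda>n. X n \<omega>) n} \<inter> {\<omega> \<in> space M. X (Suc n) \<omega> < b})" by auto
    also have "\<dots> \<in> sets (F (Suc n))"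
      using Xset[of "\<lambda>x. x \<le> a" "Suc n"] Xset[of "\<lambda>x. x < b" "Suc n"] Fmono[OF Suc]
      by (intro sets.Un sets.Int) simp_all
    finally show ?case .
  qed
  have cross: "AE \<omega> in M. eventually (\<lambda>k. \<not> (armed a b (\<lambda>n. X n \<omega>) k \<and> b \<le> X (Suc k) \<omega>)) sequentially"
    if ab: "0 \<le> a" "a < b" for a b
  proof -
    define A where "A k = {\<omega> \<in> space M. armed a b (\<lambda>n. X n \<omega>) k}" for k
    define C where "C k = {\<omega> \<in> space M. armed a b (\<lambda>n. X n \<omega>) k \<and> b \<le> X (Suc k) \<omega>}" for k
    have A[measurable]: "A k \<in> sets M" for k
      unfolding A_def using setsF[OF armed_sets] .
    have "C k = A k \<inter> {\<omega> \<in> space M. b \<le> X (Suc k) \<omega>}" for k by (auto simp: A_def C_def)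
    then have C[measurable]: "C k \<in> sets M" for k by simp
    \<comment> \<open>Whether a unit is held at time k is decided by \<open>F k\<close>, so the
      expected gain is at most 0. The open position loses at most a because X is nonnegative. The
      expected number of upcrossings is thus bounded uniformly in n.\<close>
    have bound: "(\<Sum>k<n. prob (C k)) \<le> a / (b - a)" for n
    proof -
      have ineq: "(b - a) * (\<Sum>k<n. indicator (C k) \<omega>) - a
          \<le> (\<Sum>k<n. indicator (A k) \<omega> * X (Suc k) \<omega> - indicator (A k) \<omega> * X k \<omega>)" if "\<omega> \<in> space M" for \<omega>
      proof -
        have "(b - a) * (\<Sum>k<n. indicator (C k) \<omega>) - a \<le> (b - a) * (\<Sum>k<n. of_bool (armed a b (\<lambda>n. X n \<omega>) k \<and> b \<le> X (Suc k) \<omega>))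
      + (if armed a b (\<lambda>n. X n \<omega>) n then X n \<omega> - a else 0)"
          using that nonneg[of n \<omega>] ab by (auto simp: C_def indicator_def of_bool_def)
        also have "\<dots> \<le> (\<Sum>k<n. of_bool (armed a b (\<lambda>n. X n \<omega>) k) * (X (Suc k) \<omega> - X k \<omega>))"
          by (rule upcrossings_le_gain) fact
        also have "\<dots> = (\<Sum>k<n. indicator (A k) \<omega> * X (Suc k) \<omega> - indicator (A k) \<omega> * X k \<omega>)"
          using that by (intro sum.cong refl) (auto simp: A_def indicator_def)
        finally show ?thesis .
      qed
      have intA: "integrable M (\<lambda>\<omega>. indicator (A k) \<omega> * X m \<omega>)" for k m
        using integrable_mult_indicator[OF A int, of k m] by simp
      have "(b - a) * (\<Sum>k<n. prob (C k)) - a = expectation (\<lambda>\<omega>. (b - a) * (\<Sum>k<n. indicator (C k) \<omega>) - a)"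
        by (simp add: prob_space less_top[symmetric])
      also have "\<dots> \<le> expectation (\<lambda>\<omega>. \<Sum>k<n. indicator (A k) \<omega> * X (Suc k) \<omega> - indicator (A k) \<omega> * X k \<omega>)"
        using ineq intA by (intro integral_mono) (auto simp: less_top[symmetric])
      also have "\<dots> = (\<Sum>k<n. expectation (\<lambda>\<omega>. indicator (A k) \<omega> * X (Suc k) \<omega>) - expectation (\<lambda>\<omega>. indicator (A k) \<omega> * X k \<omega>))"
        using intA by simp
      also have "\<dots> \<le> 0"
        using super[OF armed_sets] by (intro sum_nonpos) (simp add: A_def)
      finally show ?thesis using ab by (simp add: field_simps)
    qed
    have "summable (\<lambda>k. prob (C k))"
      by (rule summableI_nonneg_bounded[OF _ bound]) simp
    then have "AE \<omega> in M. eventually (\<lambda>k. \<omega> \<in> space M - C k) sequentially"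
      by (intro borel_cantelli_AE1) (auto simp: emeasure_eq_measure)
    then show ?thesis
      by (rule AE_mp) (auto intro!: AE_I2 simp: C_def elim: eventually_mono)
  qed
  have "AE \<omega> in M. \<forall>a\<in>\<rat>. \<forall>b\<in>\<rat>. 0 \<le> a \<longrightarrow> a < b \<longrightarrow>
      eventually (\<lambda>k. \<not> (armed a b (\<lambda>n. X n \<omega>) k \<and> b \<le> X (Suc k) \<omega>)) sequentially"
    by (intro AE_ball_countable[THEN iffD2] ballI countable_rat AE_impI cross) auto
  \<comment> \<open>Fatou controls only the lower limit, which is why
    \<open>convergent_if_no_crossings\<close> asks for boundedness along a subsequence.\<close>
  moreover have "AE \<omega> in M. liminf (\<lambda>n. ennreal (X n \<omega>)) \<noteq> \<infinity>"
  proof (rule nn_integral_noteq_infinite)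
    have le: "(\<integral>\<omega>. X n \<omega> \<partial>M) \<le> (\<integral>\<omega>. X 0 \<omega> \<partial>M)" for n
    proof (induction n)
      case (Suc n)
      have "(\<integral>\<omega>. indicator (space M) \<omega> * X m \<omega> \<partial>M) = (\<integral>\<omega>. X m \<omega> \<partial>M)" for m
        by (intro Bochner_Integration.integral_cong) auto
      then show ?case using super[of "space M" n] Suc sets.top[of "F n"] by (simp add: sp)
    qed simp
    have "(\<integral>\<^sup>+\<omega>. liminf (\<lambda>n. ennreal (X n \<omega>)) \<partial>M) \<le> liminf (\<lambda>n. \<integral>\<^sup>+\<omega>. ennreal (X n \<omega>) \<partial>M)"
      by (rule nn_integral_liminf) simp
    also have "\<dots> \<le> liminf (\<lambda>n::nat. ennreal (\<integral>\<omega>. X 0 \<omega> \<partial>M))"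
      using le by (intro Liminf_mono always_eventually allI)
        (simp add: nn_integral_eq_integral[OF int] nonneg ennreal_leI)
    also have "\<dots> < \<infinity>"
      by (simp add: Liminf_const)
    finally show "(\<integral>\<^sup>+\<omega>. liminf (\<lambda>n. ennreal (X n \<omega>)) \<partial>M) \<noteq> \<infinity>" by simp
  qed simp
  ultimately show ?thesis
  proof eventually_elim
    case (elim \<omega>)
    have "\<exists>K. frequently (\<lambda>n. X n \<omega> \<le> K) sequentially"
    proof (rule ccontr)
      assume no: "\<not> ?thesis"
      have "of_nat k \<le> liminf (\<lambda>n. ennreal (X n \<omega>))" for k
      proof (rule Liminf_bounded)
        have "eventually (\<lambda>n. real k < X n \<omega>) sequentially"
          using no by (auto simp: not_frequently not_le)
        then show "eventually (\<lambda>n. of_nat k \<le> ennreal (X n \<omega>)) sequentially"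
          by eventually_elim (simp add: ennreal_of_nat_eq_real_of_nat ennreal_leI)
      qed
      moreover obtain k where "liminf (\<lambda>n. ennreal (X n \<omega>)) < of_nat k"
        using elim(2) ennreal_Ex_less_of_nat by (auto simp: less_top)
      ultimately show False by (metis not_le)
    qed
    then obtain K where "frequently (\<lambda>n. X n \<omega> \<le> K) sequentially" ..
    then show ?case
      using elim(1) nonneg by (intro convergent_if_no_crossings not_frequently_crossing) auto
  qed
qed

section \<open>Competing exponential clocks\<close>

text \<open>
  Ties do not spoil measurability: the chosen minimiser is a function of the set of all minimisers,
  which takes finitely many values.
\<close>

lemma arg_min_on_sets:
  fixes f :: "'b \<Rightarrow> 'a \<Rightarrow> real"
  assumes "finite V" and f: "\<And>u. u \<in> V \<Longrightarrow> f u \<in> borel_measurable N"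
  shows "{\<omega> \<in> space N. arg_min_on (\<lambda>u. f u \<omega>) V = v} \<in> sets N"
proof -
  define m where "m \<omega> = {x \<in> V. \<forall>y\<in>V. f x \<omega> \<le> f y \<omega>}" for \<omega>
  define \<phi> where "\<phi> S = (SOME x. x \<in> S)" for S :: "'b set"
  have eq: "arg_min_on (\<lambda>u. f u \<omega>) V = \<phi> (m \<omega>)" for \<omega>
    unfolding arg_min_on_def arg_min_def is_arg_min_def m_def \<phi>_def
    by (rule arg_cong[where f = Eps]) (auto simp: not_less)
  have "{\<omega> \<in> space N. f x \<omega> \<le> f y \<omega>} \<in> sets N" if "x \<in> V" "y \<in> V" for x y
    using f[OF that(1)] f[OF that(2)] by measurable
  then have mem: "{\<omega> \<in> space N. x \<in> m \<omega>} \<in> sets N" if "x \<in> V" for x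
    using that \<open>finite V\<close> unfolding m_def by (auto intro!: sets.sets_Collect)
  have "{\<omega> \<in> space N. \<forall>x\<in>V. x \<in> m \<omega> \<longleftrightarrow> x \<in> S} \<in> sets N" for S
    using mem \<open>finite V\<close> by (intro sets.sets_Collect_finite_All sets.sets_Collect) auto
  then have "(\<Union>S\<in>{S \<in> Pow V. \<phi> S = v}. {\<omega> \<in> space N. \<forall>x\<in>V. x \<in> m \<omega> \<longleftrightarrow> x \<in> S}) \<in> sets N"
    using \<open>finite V\<close> by (intro sets.finite_UN) auto
  also have "(\<Union>S\<in>{S \<in> Pow V. \<phi> S = v}. {\<omega> \<in> space N. \<forall>x\<in>V. x \<in> m \<omega> \<longleftrightarrow> x \<in> S})
      = {\<omega> \<in> space N. arg_min_on (\<lambda>u. f u \<omega>) V = v}"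
  proof -
    have m: "m \<omega> \<in> Pow V" for \<omega> by (auto simp: m_def)
    have "(\<forall>x\<in>V. x \<in> m \<omega> \<longleftrightarrow> x \<in> S) \<longleftrightarrow> m \<omega> = S" if "S \<in> Pow V" for \<omega> S
      using that m[of \<omega>] by auto
    then show ?thesis using m by (auto simp: eq)
  qed
  finally show ?thesis .
qed

context prob_space
begin

lemma exponential_distributed_scale:
  assumes X: "distributed M lborel X (exponential_density 1)" and r: "0 < r"
  shows "distributed M lborel (\<lambda>\<omega>. X \<omega> / r) (exponential_density r)"
proof -
  have [measurable]: "X \<in> borel_measurable M"
    using X by (simp add: exponential_distributed_iff)
  have "\<P>(\<omega> in M. X \<omega> / r \<le> a) = 1 - exp (- a * r)" if "0 \<le> a" for a
  proof -
    have "\<P>(\<omega> in M. X \<omega> / r \<le> a) = \<P>(\<omega> in M. X \<omega> \<le> a * r)"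
      using r by (simp add: field_simps)
    then show ?thesis
      using exponential_distributedD_le[OF X, of "a * r"] r that by simp
  qed
  then show ?thesis using r by (subst exponential_distributed_iff) auto
qed

text \<open>Given X = x, the event has probability exp (- u x). Multiplied by the density of X this
  is l / (l + u) times the density of rate l + u, which integrates to 1.\<close>

lemma exponential_race:
  assumes X: "distributed M lborel X (exponential_density l)" and l: "0 < l"
    and Y: "distributed M lborel Y (exponential_density u)" and u: "0 < u"
    and ind: "indep_var borel X borel Y"
  shows "prob {\<omega> \<in> space M. X \<omega> < Y \<omega>} = l / (l + u)"
proof -
  have [measurable]: "X \<in> borel_measurable M" "Y \<in> borel_measurable M"
    using X Y l u by (simp_all add: exponential_distributed_iff)
  interpret DY: prob_space "distr M borel Y" by (rule prob_space_distr) simp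
  have tail: "emeasure (distr M borel Y) {x<..} = ennreal (exp (- x * u))" if "0 \<le> x" for x
  proof -
    have "emeasure (distr M borel Y) {x<..} = emeasure M {\<omega> \<in> space M. x < Y \<omega>}"
      by (subst emeasure_distr) (auto intro!: arg_cong[where f = "emeasure M"])
    also have "\<dots> = ennreal (exp (- x * u))"
      using exponential_distributedD_gt[OF Y that u] by (simp add: emeasure_eq_measure)
    finally show ?thesis .
  qed
  have S: "{z :: real \<times> real. fst z < snd z} \<in> sets (borel \<Otimes>\<^sub>M borel)"
  proof -
    have "{z \<in> space (borel \<Otimes>\<^sub>M borel). fst z < (snd z :: real)} \<in> sets (borel \<Otimes>\<^sub>M borel)"
      by measurable
    then show ?thesis by (simp add: space_pair_measure)
  qed
  have [measurable]: "(\<lambda>x. emeasure (distr M borel Y) {x<..}) \<in> borel_measurable borel"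
  proof -
    have "(\<lambda>x. emeasure (distr M borel Y) (Pair x -` {z. fst z < snd z})) \<in> borel_measurable borel"
      by (rule DY.measurable_emeasure_Pair) (use S in \<open>simp cong: sets_pair_measure_cong\<close>)
    then show ?thesis by (simp add: vimage_def greaterThan_def)
  qed
  have "emeasure M {\<omega> \<in> space M. X \<omega> < Y \<omega>}
      = emeasure (distr M (borel \<Otimes>\<^sub>M borel) (\<lambda>\<omega>. (X \<omega>, Y \<omega>))) {z. fst z < snd z}"
    using S by (subst emeasure_distr) (auto intro!: arg_cong[where f = "emeasure M"])
  also have "\<dots> = emeasure (distr M borel X \<Otimes>\<^sub>M distr M borel Y) {z. fst z < snd z}"
    using ind by (simp add: indep_var_distribution_eq)
  also have "\<dots> = (\<integral>\<^sup>+x. emeasure (distr M borel Y) (Pair x -` {z. fst z < snd z}) \<partial>distr M borel X)"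
    using S sets_pair_measure_cong[of "distr M borel X" borel "distr M borel Y" borel]
    by (intro DY.emeasure_pair_measure_alt) simp
  also have "\<dots> = (\<integral>\<^sup>+x. emeasure (distr M borel Y) {x<..} \<partial>distr M lborel X)"
    by (intro nn_integral_cong_simp arg_cong2[where f = nn_integral] ext
        arg_cong2[where f = emeasure] distr_cong) auto
  also have "\<dots> = (\<integral>\<^sup>+x. emeasure (distr M borel Y) {x<..} \<partial>density lborel (\<lambda>x. ennreal (exponential_density l x)))"
    using X by (simp add: distributed_distr_eq_density)
  also have "\<dots> = (\<integral>\<^sup>+x. ennreal (exponential_density l x) * emeasure (distr M borel Y) {x<..} \<partial>lborel)"
    by (rule nn_integral_density) auto
  also have "\<dots> = (\<integral>\<^sup>+x. ennreal (l / (l + u)) * ennreal (exponential_density (l + u) x) \<partial>lborel)"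
  proof (intro nn_integral_cong)
    fix x :: real
    show "ennreal (exponential_density l x) * emeasure (distr M borel Y) {x<..} =
         ennreal (l / (l + u)) * ennreal (exponential_density (l + u) x)"
    proof (cases "x < 0")
      case False
      have "exponential_density l x * exp (- x * u) = l / (l + u) * exponential_density (l + u) x"
        using l u False by (simp add: exponential_density_def exp_add[symmetric] algebra_simps add_divide_distrib[symmetric])
          (simp add: field_simps)
      then show ?thesis
        using l u False exponential_density_nonneg[of l x] exponential_density_nonneg[of "l + u" x]
        by (simp add: tail ennreal_mult[symmetric])
    qed (simp add: exponential_density_def)
  qed
  also have "\<dots> = ennreal (l / (l + u)) * (\<integral>\<^sup>+x. ennreal (exponential_density (l + u) x) \<partial>lborel)"
    by (rule nn_integral_cmult) simp
  also have "(\<integral>\<^sup>+x. ennreal (exponential_density (l + u) x) \<partial>lborel) = 1"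
    using prob_space.emeasure_space_1[OF prob_space_exponential_density[of "l + u"]] l u
    by (simp add: emeasure_density)
  finally show ?thesis
    using l u by (simp add: emeasure_eq_measure)
qed

text \<open>
  Each candidate wins strictly with at least the claimed probability, and the claimed probabilities
  already sum to 1; so ties need no separate treatment.
\<close>

lemma exponential_arg_min:
  fixes X :: "'b \<Rightarrow> 'a \<Rightarrow> real"
  assumes "finite V" "v \<in> V"
    and l: "\<And>u. u \<in> V \<Longrightarrow> 0 < l u"
    and X: "\<And>u. u \<in> V \<Longrightarrow> distributed M lborel (X u) (exponential_density (l u))"
    and ind: "indep_vars (\<lambda>_. borel) X V"
  shows "prob {\<omega> \<in> space M. arg_min_on (\<lambda>u. X u \<omega>) V = v} = l v / (\<Sum>u\<in>V. l u)"
proof -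
  have [measurable]: "X u \<in> borel_measurable M" if "u \<in> V" for u
    using X[OF that] l[OF that] by (simp add: exponential_distributed_iff)
  define W where "W v = {\<omega> \<in> space M. arg_min_on (\<lambda>u. X u \<omega>) V = v}" for v
  have W[measurable]: "W v \<in> sets M" for v
    unfolding W_def using assms(1) by (intro arg_min_on_sets) auto
  have V0: "V \<noteq> {}" using assms by auto
  have in_V: "arg_min_on (\<lambda>u. X u \<omega>) V \<in> V" for \<omega>
    using arg_min_if_finite(1)[OF \<open>finite V\<close> V0] .
  have pos: "0 < (\<Sum>u\<in>V. l u)"
    using assms V0 by (intro sum_pos) auto
  have lower: "l v / (\<Sum>u\<in>V. l u) \<le> prob (W v)" if v: "v \<in> V" for v
  proof (cases "V = {v}")
    \<comment> \<open>A lone candidate is treated apart because the minimum over the rivals needs a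
      nonempty set.\<close>
    case True
    then have "W v = space M" using in_V by (auto simp: W_def)
    then show ?thesis using True l[OF v] by (simp add: prob_space)
  next
    case False
    define R where "R = V - {v}"
    have R: "finite R" "R \<noteq> {}" "v \<notin> R" "insert v R = V" using False v \<open>finite V\<close> by (auto simp: R_def)
    \<comment> \<open>All rivals are merged into one: the minimum of independent exponentials is
      exponential with the summed rate, which leaves a race of two.\<close>
    have "distributed M lborel (\<lambda>\<omega>. Min ((\<lambda>u. X u \<omega>) ` R)) (exponential_density (\<Sum>u\<in>R. l u))"
      using R l X indep_vars_subset[OF ind, of R] by (intro exponential_distributed_Min) auto
    moreover have "indep_var borel (X v) borel (\<lambda>\<omega>. Min ((\<lambda>u. X u \<omega>) ` R))"
      using R ind by (intro indep_vars_Min) auto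
    moreover have "0 < (\<Sum>u\<in>R. l u)"
      using R l by (intro sum_pos) auto
    ultimately have "prob {\<omega> \<in> space M. X v \<omega> < Min ((\<lambda>u. X u \<omega>) ` R)} = l v / (l v + (\<Sum>u\<in>R. l u))"
      using l[OF v] X[OF v] by (intro exponential_race) auto
    also have "l v + (\<Sum>u\<in>R. l u) = (\<Sum>u\<in>V. l u)"
      using R by (metis sum.insert)
    finally have "l v / (\<Sum>u\<in>V. l u) = prob {\<omega> \<in> space M. X v \<omega> < Min ((\<lambda>u. X u \<omega>) ` R)}" ..
    also have "\<dots> \<le> prob (W v)"
    proof (rule finite_measure_mono)
      show "{\<omega> \<in> space M. X v \<omega> < Min ((\<lambda>u. X u \<omega>) ` R)} \<subseteq> W v"
      proof safe
        fix \<omega> assume "\<omega> \<in> space M" and lt: "X v \<omega> < Min ((\<lambda>u. X u \<omega>) ` R)"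
        have "\<not> X v \<omega> < X (arg_min_on (\<lambda>u. X u \<omega>) V) \<omega>"
          using arg_min_if_finite(2)[OF \<open>finite V\<close> V0, of "\<lambda>u. X u \<omega>"] v by blast
        moreover have "X v \<omega> < X u \<omega>" if "u \<in> R" for u
          using lt R that by (subst (asm) Min_gr_iff) auto
        ultimately show "\<omega> \<in> W v"
          using in_V[of \<omega>] \<open>\<omega> \<in> space M\<close> by (auto simp: W_def R_def)
      qed
    qed simp
    finally show ?thesis .
  qed
  have "(\<Sum>u\<in>V. prob (W u)) = prob (\<Union>u\<in>V. W u)"
    using \<open>finite V\<close> by (intro finite_measure_finite_Union[symmetric]) (use W in \<open>auto simp: disjoint_family_on_def W_def\<close>)
  also have "(\<Union>u\<in>V. W u) = space M"
    using in_V by (auto simp: W_def)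
  finally have sum1: "(\<Sum>u\<in>V. prob (W u)) = 1" by (simp add: prob_space)
  have "(\<Sum>u\<in>V. prob (W u) - l u / (\<Sum>u\<in>V. l u)) = 0"
    using pos by (simp add: sum_subtractf sum1 sum_divide_distrib[symmetric])
  then have "prob (W v) - l v / (\<Sum>u\<in>V. l u) = 0"
    using \<open>finite V\<close> \<open>v \<in> V\<close> lower by (subst (asm) sum_nonneg_eq_0_iff) auto
  then show ?thesis by (simp add: W_def)
qed

end

section \<open>The degree processes as functions of the driving sources\<close>

context prob_space
begin

text \<open>By injectivity the singletons {f j} are disjoint blocks, and independence of the
  restrictions to disjoint blocks applies.\<close>

lemma indep_vars_reindex:
  assumes ind: "indep_vars (\<lambda>_. borel) X I" and f: "f ` J \<subseteq> I" "inj_on f J"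
  shows "indep_vars (\<lambda>_. borel) (\<lambda>j. X (f j)) J"
proof -
  have "indep_vars (\<lambda>j. PiM {f j} (\<lambda>_. borel)) (\<lambda>j \<omega>. restrict (\<lambda>i. X i \<omega>) {f j}) J"
    by (rule indep_vars_restrict[OF ind])
      (use f in \<open>auto simp: disjoint_family_on_def dest: inj_onD\<close>)
  from indep_vars_compose2[OF this, of "\<lambda>j x. x (f j)" "\<lambda>_. borel"]
  show ?thesis by simp
qed

text \<open>Realised as the preimage algebra of the restricted tuple, so that its events have
  exactly the form handled by independence of restrictions to disjoint index sets.\<close>

definition generated :: "('s \<Rightarrow> 'a \<Rightarrow> real) \<Rightarrow> 's set \<Rightarrow> 'a measure" where
  "generated X A = vimage_algebra (space M) (\<lambda>\<omega>. \<lambda>s\<in>A. X s \<omega>) (PiM A (\<lambda>_. borel))"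

lemma space_generated [simp]: "space (generated X A) = space M"
  by (simp add: generated_def)

lemma measurable_generated:
  assumes "s \<in> A"
  shows "X s \<in> borel_measurable (generated X A)"
proof -
  have "(\<lambda>\<omega>. \<lambda>s\<in>A. X s \<omega>) \<in> measurable (generated X A) (PiM A (\<lambda>_. borel))"
    unfolding generated_def by (rule measurable_vimage_algebra1) (auto simp: space_PiM)
  from measurable_compose[OF this measurable_component_singleton[OF assms]] assms
  show ?thesis by simp
qed

lemma sets_generated_subset:
  assumes "\<And>s. s \<in> A \<Longrightarrow> X s \<in> borel_measurable N" and sp: "space N = space M"
  shows "sets (generated X A) \<subseteq> sets N"
proof -
  have "(\<lambda>\<omega>. \<lambda>s\<in>A. X s \<omega>) \<in> measurable N (PiM A (\<lambda>_. borel))"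
    using assms by (intro measurable_restrict) auto
  then show ?thesis
    unfolding generated_def sp[symmetric]
    by (subst sets_vimage_algebra2) (auto simp: space_PiM)
qed

lemma sets_generated_mono: "A \<subseteq> A' \<Longrightarrow> E \<in> sets (generated X A) \<Longrightarrow> E \<in> sets (generated X A')"
  using sets_generated_subset[of A X "generated X A'"] by (auto intro: measurable_generated)

lemma sets_generated_events:
  assumes "indep_vars (\<lambda>_. borel) X I" "A \<subseteq> I" "E \<in> sets (generated X A)"
  shows "E \<in> events"
proof -
  have "sets (generated X A) \<subseteq> events"
    by (rule sets_generated_subset) (use assms in \<open>auto simp: indep_vars_def\<close>)
  then show ?thesis using assms(3) by auto
qed

text \<open>Each event is the preimage of a set under a restricted tuple, so the intersection is the
  preimage of a rectangle under the pair of tuples.\<close>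

lemma prob_Int_generated:
  assumes ind: "indep_vars (\<lambda>_. borel) X I" and A: "A \<subseteq> I" "A' \<subseteq> I" "A \<inter> A' = {}"
    and E: "E \<in> sets (generated X A)" "E' \<in> sets (generated X A')"
  shows "prob (E \<inter> E') = prob E * prob E'"
proof -
  have *: "\<exists>S\<in>sets (PiM A (\<lambda>_. borel)). E = (\<lambda>\<omega>. \<lambda>s\<in>A. X s \<omega>) -` S \<inter> space M"
    if "E \<in> sets (generated X A)" for E A
    using that unfolding generated_def
    by (subst (asm) sets_vimage_algebra2) (auto simp: space_PiM)
  obtain S S' where S: "S \<in> sets (PiM A (\<lambda>_. borel))" "E = (\<lambda>\<omega>. \<lambda>s\<in>A. X s \<omega>) -` S \<inter> space M"
      "S' \<in> sets (PiM A' (\<lambda>_. borel))" "E' = (\<lambda>\<omega>. \<lambda>s\<in>A'. X s \<omega>) -` S' \<inter> space M"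
    using *[OF E(1)] *[OF E(2)] by metis
  have "E \<inter> E' = (\<lambda>x. (\<lambda>s\<in>A. X s x, \<lambda>s\<in>A'. X s x)) -` (S \<times> S') \<inter> space M"
    unfolding S by auto
  then show ?thesis
    using indep_varD[OF indep_var_restrict[OF ind A(3,1,2)] S(1,3)] S(2,4) by simp
qed

end

text \<open>The sources are coerced to the reals for the sake of a common value type; the floor
  function brings counts back.\<close>

lemma measurable_count_space_of_real:
  fixes f :: "'a \<Rightarrow> nat"
  assumes "(\<lambda>\<omega>. real (f \<omega>)) \<in> borel_measurable N"
  shows "f \<in> measurable N (count_space UNIV)"
proof -
  have "(\<lambda>\<omega>. nat \<lfloor>real (f \<omega>)\<rfloor>) \<in> measurable N (count_space UNIV)"
    using assms by measurable
  then show ?thesis by simp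
qed

text \<open>Setting \<theta> to 0 ignores coins and newborn endpoints and gives in-degrees; \<theta>
  = 1 gives out-degrees. The edge range, the number N of nodes and the old degrees d are plain
  arguments, so that on a fixed history only coins and clocks remain random.\<close>

definition degree_step where
  "degree_step \<theta> \<delta> T B m m' N d \<omega> v = d v + (\<Sum>k = m + 1..m'.
      (1 - \<theta> * B k \<omega>) * of_bool (v = attach \<delta> d {1..N} (\<lambda>u. T k u \<omega>))
      + \<theta> * B k \<omega> * of_bool (v = 1 + (\<Sum>j=1..k. B j \<omega>)))"
  for \<theta> :: nat and \<delta> :: real and T :: "nat \<Rightarrow> nat \<Rightarrow> 'a \<Rightarrow> real" and B :: "nat \<Rightarrow> 'a \<Rightarrow> nat"

definition node_count where
  "node_count B m \<omega> = 1 + (\<Sum>k=1..m. B k \<omega>)" for B :: "nat \<Rightarrow> 'a \<Rightarrow> nat"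

primrec pa_degree :: "nat \<Rightarrow> real \<Rightarrow> (nat \<Rightarrow> nat \<Rightarrow> 'a \<Rightarrow> real) \<Rightarrow> (nat \<Rightarrow> 'a \<Rightarrow> nat) \<Rightarrow> (nat \<Rightarrow> 'a \<Rightarrow> nat) \<Rightarrow>
    nat \<Rightarrow> 'a \<Rightarrow> nat \<Rightarrow> nat" where
  "pa_degree \<theta> \<delta> T B dM 0 \<omega> = (\<lambda>v. of_bool (v = 1))"
| "pa_degree \<theta> \<delta> T B dM (Suc n) \<omega> = degree_step \<theta> \<delta> T B (edge_count dM n \<omega>) (edge_count dM (Suc n) \<omega>)
     (node_count B (edge_count dM n \<omega>) \<omega>) (pa_degree \<theta> \<delta> T B dM n \<omega>) \<omega>"

lemma nodes_eq: "nodes B dM n \<omega> = {1..node_count B (edge_count dM n \<omega>) \<omega>}"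
  by (simp add: nodes_def node_count_def)

lemma in_degree_eq: "in_degree \<delta> T B dM n \<omega> = pa_degree 0 \<delta> T B dM n \<omega>"
proof (induction n)
  case (Suc n)
  then show ?case
    by (intro ext) (simp add: degree_step_def nodes_eq)
qed (simp add: fun_eq_iff)

lemma out_degree_eq: "out_degree \<delta> T B dM n \<omega> = pa_degree 1 \<delta> T B dM n \<omega>"
proof (induction n)
  case (Suc n)
  then show ?case
    by (intro ext) (simp add: degree_step_def nodes_eq)
qed (simp add: fun_eq_iff)

lemma edge_count_Suc: "edge_count dM (Suc n) \<omega> = edge_count dM n \<omega> + dM (Suc n) \<omega>"
  by (simp add: edge_count_def)

lemma node_count_mono: "m \<le> m' \<Longrightarrow> node_count B m \<omega> \<le> node_count B m' \<omega>"
  unfolding node_count_def by (intro add_mono sum_mono2) auto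

lemma edge_count_mono: "n \<le> n' \<Longrightarrow> edge_count dM n \<omega> \<le> edge_count dM n' \<omega>"
  unfolding edge_count_def by (intro sum_mono2) auto

lemma attach_in:
  assumes "0 < N"
  shows "attach \<delta> d {1..N} t \<in> {1..N}"
  unfolding attach_def using assms by (intro arg_min_if_finite) auto

text \<open>A chosen endpoint lies in the current node set, and the newborn label at edge k is the
  node count after k edges. It follows that a finite list can store the whole degree
  function.\<close>

lemma degree_eq_0:
  assumes "v \<notin> {1..node_count B (edge_count dM n \<omega>) \<omega>}"
  shows "pa_degree \<theta> \<delta> T B dM n \<omega> v = 0"
  using assms
proof (induction n arbitrary: v)
  case 0 then show ?case by (auto simp: node_count_def edge_count_def)
next
  case (Suc n)
  let ?m = "edge_count dM n \<omega>" and ?m' = "edge_count dM (Suc n) \<omega>"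
  have le: "node_count B ?m \<omega> \<le> node_count B ?m' \<omega>"
    by (intro node_count_mono edge_count_mono) simp
  have 1: "v \<notin> {1..node_count B ?m \<omega>}" using Suc.prems le by auto
  have "v \<noteq> attach \<delta> (pa_degree \<theta> \<delta> T B dM n \<omega>) {1..node_count B ?m \<omega>} t" for t
    using attach_in[of "node_count B ?m \<omega>"] 1 by (metis node_count_def add_is_0 neq0_conv zero_neq_one)
  moreover have "v \<noteq> 1 + (\<Sum>j=1..k. B j \<omega>)" if "k \<le> ?m'" for k
    using node_count_mono[OF that, of B \<omega>] Suc.prems by (auto simp: node_count_def)
  ultimately show ?case
    using Suc.IH[OF 1] by (simp add: degree_step_def)
qed

text \<open>Each edge contributes exactly one unit, because \<open>B k \<omega> \<le> 1\<close>.\<close>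

lemma sum_degree:
  assumes B: "\<And>k. k \<ge> 1 \<Longrightarrow> B k \<omega> \<le> 1" and \<theta>: "\<theta> \<le> 1"
  shows "(\<Sum>v=1..node_count B (edge_count dM n \<omega>) \<omega>. pa_degree \<theta> \<delta> T B dM n \<omega> v) = edge_count dM n \<omega> + 1"
proof (induction n)
  case 0 then show ?case by (simp add: node_count_def edge_count_def)
next
  case (Suc n)
  let ?m = "edge_count dM n \<omega>" and ?m' = "edge_count dM (Suc n) \<omega>"
  let ?N = "node_count B ?m \<omega>" and ?N' = "node_count B ?m' \<omega>"
  let ?d = "pa_degree \<theta> \<delta> T B dM n \<omega>"
  let ?a = "\<lambda>k. attach \<delta> ?d {1..?N} (\<lambda>u. T k u \<omega>)" and ?b = "\<lambda>k. 1 + (\<Sum>j=1..k. B j \<omega>)"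
  have le: "?N \<le> ?N'"
    by (intro node_count_mono edge_count_mono) simp
  have a: "?a k \<in> {1..?N'}" for k
    using attach_in[of ?N] le by (fastforce simp: node_count_def)
  have b: "?b k \<in> {1..?N'}" if "k \<le> ?m'" for k
    using node_count_mono[OF that, of B \<omega>] by (auto simp: node_count_def)
  have old: "(\<Sum>v=1..?N'. ?d v) = (\<Sum>v=1..?N. ?d v)"
    using le by (intro sum.mono_neutral_right) (auto intro!: degree_eq_0)
  have unit: "(\<Sum>v=1..?N'. (1 - \<theta> * B k \<omega>) * of_bool (v = ?a k) + \<theta> * B k \<omega> * of_bool (v = ?b k)) = 1"
    if k: "k \<in> {?m + 1..?m'}" for k
  proof -
    have "(\<Sum>v=1..?N'. of_bool (v = ?a k)) = (1::nat)"
      using a[of k] by (simp add: of_bool_def del: atLeastAtMost_iff)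
    moreover have "(\<Sum>v=1..?N'. of_bool (v = ?b k)) = (1::nat)"
      using b[of k] k by (simp add: of_bool_def)
    moreover have "\<theta> * B k \<omega> \<le> 1"
      using B[of k] \<theta> k by (intro mult_le_one) auto
    ultimately show ?thesis by (simp add: sum.distrib sum_distrib_left[symmetric])
  qed
  have "(\<Sum>v=1..?N'. pa_degree \<theta> \<delta> T B dM (Suc n) \<omega> v)
      = (\<Sum>v=1..?N'. ?d v) + (\<Sum>k = ?m + 1..?m'. 1)"
    unfolding pa_degree.simps degree_step_def sum.distrib[of ?d]
    by (subst sum.swap, subst sum.cong[OF refl unit]) simp_all
  also have "\<dots> = edge_count dM (Suc n) \<omega> + 1"
    using old Suc.IH by (simp add: edge_count_Suc)
  finally show ?case .
qed

lemma real_node_count: "real (node_count B m \<omega>) = 1 + (\<Sum>k=1..m. real (B k \<omega>))"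
  by (simp add: node_count_def)

lemma map_upt_eq_iff:
  "map f [1..<Suc N] = l \<longleftrightarrow> N = length l \<and> (\<forall>i\<in>{..<length l}. f (Suc i) = l ! i)"
proof -
  have "map f [1..<Suc N] = l \<longleftrightarrow> length (map f [1..<Suc N]) = length l \<and>
      (\<forall>i<length l. map f [1..<Suc N] ! i = l ! i)"
    by (subst list_eq_iff_nth_eq) (auto simp del: upt_Suc)
  also have "\<dots> \<longleftrightarrow> N = length l \<and> (\<forall>i\<in>{..<length l}. f (Suc i) = l ! i)"
    by (auto simp del: upt_Suc)
  finally show ?thesis .
qed

section \<open>The driving sources and the part of them used so far\<close>

context pa_driving
begin

definition src :: "source \<Rightarrow> 'a \<Rightarrow> real" where
  "src s \<omega> = (case s of Coin k \<Rightarrow> real (B k \<omega>) | In_Clock k v \<Rightarrow> \<tau> k v \<omega>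
    | Out_Clock k v \<Rightarrow> \<tau>' k v \<omega> | Batch k \<Rightarrow> real (dM k \<omega>))"

definition sources :: "source set" where
  "sources = {Coin k |k. k \<ge> 1} \<union> {In_Clock k v |k v. k \<ge> 1 \<and> v \<ge> 1} \<union>
       {Out_Clock k v |k v. k \<ge> 1 \<and> v \<ge> 1} \<union> {Batch k |k. k \<ge> 1}"

text \<open>Here m is a number, not the random edge count. Clocks at all nodes are included, so that
  the random number of nodes does not enter.\<close>

definition past :: "nat \<Rightarrow> nat \<Rightarrow> source set" where
  "past n m = {Coin k |k. k \<in> {1..m}} \<union> {In_Clock k v |k v. k \<in> {1..m} \<and> v \<ge> 1} \<union>
       {Out_Clock k v |k v. k \<in> {1..m} \<and> v \<ge> 1} \<union> {Batch k |k. k \<in> {1..n}}"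

lemma past_subset: "past n m \<subseteq> sources"
  by (auto simp: past_def sources_def)

lemma past_mono: "n \<le> n' \<Longrightarrow> m \<le> m' \<Longrightarrow> past n m \<subseteq> past n' m'"
  unfolding past_def by fastforce

lemma indep_src: "indep_vars (\<lambda>_. borel) src sources"
  using indep unfolding sources_def src_def[abs_def] .

lemmas src_events = sets_generated_events[OF indep_src]
lemmas prob_Int_src = prob_Int_generated[OF indep_src]

lemma B_generated:
  assumes "Coin k \<in> A"
  shows "B k \<in> measurable (generated src A) (count_space UNIV)"
  using measurable_generated[OF assms, of src]
  by (intro measurable_count_space_of_real) (simp add: src_def[abs_def])

lemma dM_generated:
  assumes "Batch k \<in> A"
  shows "dM k \<in> measurable (generated src A) (count_space UNIV)"
  using measurable_generated[OF assms, of src]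
  by (intro measurable_count_space_of_real) (simp add: src_def[abs_def])

text \<open>The prescribed masses p and 1 - p already add up to 1. The coins are declared only as
  natural numbers, so this holds outside a null set.\<close>

lemma AE_B_le_1: "AE \<omega> in M. \<forall>k\<ge>1. B k \<omega> \<le> 1"
proof -
  have "AE \<omega> in M. k \<ge> 1 \<longrightarrow> B k \<omega> \<le> 1" for k
  proof (cases "k \<ge> 1")
    case True
    have [measurable]: "B k \<in> measurable M (count_space UNIV)" using B_rv[OF True] .
    have "prob ({\<omega> \<in> space M. B k \<omega> = 1} \<union> {\<omega> \<in> space M. B k \<omega> = 0})
        = prob {\<omega> \<in> space M. B k \<omega> = 1} + prob {\<omega> \<in> space M. B k \<omega> = 0}"
      by (rule finite_measure_Union) auto
    also have "\<dots> = 1" using B_one[OF True] B_zero[OF True] by simp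
    finally have "AE \<omega> in M. \<omega> \<in> {\<omega> \<in> space M. B k \<omega> = 1} \<union> {\<omega> \<in> space M. B k \<omega> = 0}"
      by (intro AE_prob_1) auto
    then show ?thesis by eventually_elim auto
  qed simp
  then show ?thesis by (simp add: AE_all_countable)
qed

end

text \<open>Serves both degrees: \<theta> = 0 with \<open>In_Clock\<close>, and \<theta> = 1 with
  \<open>Out_Clock\<close>.\<close>

locale pa_degree_process = pa_driving +
  fixes \<theta> :: nat and \<delta> :: real and clock :: "nat \<Rightarrow> nat \<Rightarrow> source"
  assumes p: "0 < p" "p < 1" and lam: "0 < lam" and \<theta>: "\<theta> \<le> 1" and \<delta>: "0 < \<delta>"
    and clock: "clock = In_Clock \<or> clock = Out_Clock"
begin

abbreviation T :: "nat \<Rightarrow> nat \<Rightarrow> 'a \<Rightarrow> real" where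
  "T k u \<equiv> src (clock k u)"

abbreviation edges :: "nat \<Rightarrow> 'a \<Rightarrow> nat" where
  "edges \<equiv> edge_count dM"

abbreviation deg :: "nat \<Rightarrow> 'a \<Rightarrow> nat \<Rightarrow> nat" where
  "deg \<equiv> pa_degree \<theta> \<delta> T B dM"

lemma clock_exp:
  assumes "k \<ge> 1" "v \<ge> 1"
  shows "distributed M lborel (T k v) (exponential_density 1)"
  using clock \<tau>_exp[OF assms] \<tau>'_exp[OF assms] by (auto simp: src_def[abs_def])

lemma clock_past: "k \<in> {1..m} \<Longrightarrow> v \<ge> 1 \<Longrightarrow> clock k v \<in> past n m"
  using clock by (auto simp: past_def)

lemma attach_generated:
  assumes "\<And>v. v \<in> {1..N} \<Longrightarrow> clock k v \<in> A"
  shows "{\<omega> \<in> space M. attach \<delta> d {1..N} (\<lambda>u. T k u \<omega>) = v} \<in> sets (generated src A)"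
  using arg_min_on_sets[of "{1..N}" "\<lambda>u \<omega>. T k u \<omega> / (real (d u) + \<delta>)" "generated src A" v]
    borel_measurable_divide[OF measurable_generated[OF assms, of _ src] borel_measurable_const]
  by (simp add: attach_def)

text \<open>Dividing a unit-rate clock by d(u) + \<delta> makes it exponential with that rate;
  \<delta> keeps the rate positive at nodes of degree 0.\<close>

lemma prob_attach:
  assumes "k \<ge> 1" "v \<in> {1..N}"
  shows "prob {\<omega> \<in> space M. attach \<delta> d {1..N} (\<lambda>u. T k u \<omega>) = v}
    = (real (d v) + \<delta>) / (\<Sum>u=1..N. real (d u) + \<delta>)"
  unfolding attach_def
proof (rule exponential_arg_min)
  have "indep_vars (\<lambda>_. borel) (\<lambda>u. src (clock k u)) {1..N}"
    by (rule indep_vars_reindex[OF indep_src])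
      (use clock assms in \<open>auto simp: sources_def intro!: inj_onI\<close>)
  from indep_vars_compose2[OF this, of "\<lambda>u x. x / (real (d u) + \<delta>)" "\<lambda>_. borel"]
  show "indep_vars (\<lambda>_. borel) (\<lambda>u \<omega>. T k u \<omega> / (real (d u) + \<delta>)) {1..N}" by simp
  show "distributed M lborel (\<lambda>\<omega>. T k u \<omega> / (real (d u) + \<delta>)) (exponential_density (real (d u) + \<delta>))"
    if "u \<in> {1..N}" for u
    using that assms \<delta> by (intro exponential_distributed_scale clock_exp) (auto intro: add_nonneg_pos)
qed (use assms \<delta> in \<open>auto intro: add_nonneg_pos\<close>)

text \<open>Position i of the list holds node i + 1. The value 0 outside the list agrees with
  \<open>degree_eq_0\<close>, so decoding restores the degree at every label.\<close>

definition list_degree :: "nat list \<Rightarrow> nat \<Rightarrow> nat" where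
  "list_degree l v = (if v \<in> {1..length l} then l ! (v - 1) else 0)"

text \<open>All steps are kept because the normalising product depends on all earlier edge and node
  counts; node counts are the list lengths. The values lie in a countable type, which makes the
  events {hist n = h} the atoms of all later computations.\<close>

definition hist :: "nat \<Rightarrow> 'a \<Rightarrow> (nat \<times> nat list) list" where
  "hist n \<omega> = map (\<lambda>k. (edges k \<omega>, map (deg k \<omega>) [1..<Suc (node_count B (edges k \<omega>) \<omega>)])) [0..<Suc n]"

lemma hist_0: "hist 0 \<omega> = [(0, [1])]"
  by (simp add: hist_def edge_count_def node_count_def)

lemma hist_Suc: "hist (Suc n) \<omega> = hist n \<omega> @
    [(edges (Suc n) \<omega>, map (deg (Suc n) \<omega>) [1..<Suc (node_count B (edges (Suc n) \<omega>) \<omega>)])]"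
  by (simp add: hist_def)

lemma length_hist [simp]: "length (hist n \<omega>) = Suc n"
  by (simp add: hist_def)

lemma hist_nth:
  assumes "hist n \<omega> = h" "k \<le> n"
  shows "fst (h ! k) = edges k \<omega>" "length (snd (h ! k)) = node_count B (edges k \<omega>) \<omega>"
    "list_degree (snd (h ! k)) = deg k \<omega>"
proof -
  have hk: "h ! k = (edges k \<omega>, map (deg k \<omega>) [1..<Suc (node_count B (edges k \<omega>) \<omega>)])"
    using assms unfolding hist_def by (auto simp del: upt_Suc)
  show "fst (h ! k) = edges k \<omega>" "length (snd (h ! k)) = node_count B (edges k \<omega>) \<omega>"
    by (simp_all add: hk)
  show "list_degree (snd (h ! k)) = deg k \<omega>"
    using degree_eq_0[of _ B dM k \<omega> \<theta> \<delta> T] by (auto simp: hk list_degree_def fun_eq_iff simp del: upt_Suc)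
qed

lemma degree_step_generated:
  assumes "m' \<le> m''"
  shows "(\<lambda>\<omega>. degree_step \<theta> \<delta> T B m m' N d \<omega> v) \<in> measurable (generated src (past n m'')) (count_space UNIV)"
proof (rule measurable_count_space_of_real)
  let ?G = "generated src (past n m'')"
  have [measurable]: "B k \<in> measurable ?G (count_space UNIV)" if "k \<in> {1..m'}" for k
    using that assms by (intro B_generated) (auto simp: past_def)
  have [measurable]: "Measurable.pred ?G (\<lambda>\<omega>. attach \<delta> d {1..N} (\<lambda>u. T k u \<omega>) = v)" if "k \<in> {1..m'}" for k
    unfolding pred_def space_generated
    using that assms by (intro attach_generated clock_past) auto
  have "(\<lambda>\<omega>. real (d v) + (\<Sum>k = m + 1..m'.
      real (1 - \<theta> * B k \<omega>) * of_bool (attach \<delta> d {1..N} (\<lambda>u. T k u \<omega>) = v)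
      + real (\<theta> * B k \<omega>) * of_bool (1 + (\<Sum>j=1..k. real (B j \<omega>)) = real v))) \<in> borel_measurable ?G"
    by measurable
  also have "(\<lambda>\<omega>. real (d v) + (\<Sum>k = m + 1..m'.
      real (1 - \<theta> * B k \<omega>) * of_bool (attach \<delta> d {1..N} (\<lambda>u. T k u \<omega>) = v)
      + real (\<theta> * B k \<omega>) * of_bool (1 + (\<Sum>j=1..k. real (B j \<omega>)) = real v)))
    = (\<lambda>\<omega>. real (degree_step \<theta> \<delta> T B m m' N d \<omega> v))"
  proof
    fix \<omega>
    have "1 + (\<Sum>j=1..k. real (B j \<omega>)) = real v \<longleftrightarrow> v = 1 + (\<Sum>j=1..k. B j \<omega>)" for k
      unfolding real_node_count[symmetric] node_count_def[symmetric] by auto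
    then show "real (d v) + (\<Sum>k = m + 1..m'.
      real (1 - \<theta> * B k \<omega>) * of_bool (attach \<delta> d {1..N} (\<lambda>u. T k u \<omega>) = v)
      + real (\<theta> * B k \<omega>) * of_bool (1 + (\<Sum>j=1..k. real (B j \<omega>)) = real v))
     = real (degree_step \<theta> \<delta> T B m m' N d \<omega> v)"
      unfolding degree_step_def by (simp add: eq_commute[of v])
  qed
  finally show "(\<lambda>\<omega>. real (degree_step \<theta> \<delta> T B m m' N d \<omega> v)) \<in> borel_measurable ?G" .
qed

text \<open>
  The history up to step \<open>n\<close> is a discrete variable, and on the event that it takes a given value
  the random number of edges is a constant \<open>m\<close>. So that event depends on the first \<open>n\<close> batches and
  on the coins and clocks of the first \<open>m\<close> edges only.
\<close>

lemma hist_generated: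
  "{\<omega> \<in> space M. hist n \<omega> = h} \<in> sets (generated src (past n (fst (last h))))"
proof (induction n arbitrary: h)
  case 0 then show ?case
    using sets.top[of "generated src (past 0 (fst (last h)))"] by (cases "h = [(0, [1])]") (auto simp: hist_0)
next
  case (Suc n)
  show ?case
  proof (cases "length h = Suc (Suc n)")
    case False
    then have "{\<omega> \<in> space M. hist (Suc n) \<omega> = h} = {}" using length_hist[of "Suc n"] by auto
    then show ?thesis by (simp only: sets.empty_sets)
  next
    case True
    then obtain h0 m' l' where h: "h = h0 @ [(m', l')]"
      by (metis append_butlast_last_id list.size(3) nat.distinct(1) surj_pair)
    have len: "length h0 = Suc n" using True h by simp
    define m where "m = fst (last h0)"
    define l where "l = snd (last h0)"
    have last: "h0 ! n = (m, l)"
      using len by (metis m_def l_def last_conv_nth diff_Suc_1 list.size(3) nat.distinct(1) prod.collapse)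
    let ?G = "generated src (past (Suc n) m')"
    show ?thesis
    proof (cases "m \<le> m'")
      case mm: True
      let ?E1 = "{\<omega> \<in> space M. hist n \<omega> = h0}"
      let ?E2 = "{\<omega> \<in> space M. m + dM (Suc n) \<omega> = m'}"
      let ?E3 = "{\<omega> \<in> space M. node_count B m' \<omega> = length l'}"
      let ?E4 = "{\<omega> \<in> space M. \<forall>i\<in>{..<length l'}. degree_step \<theta> \<delta> T B m m' (length l) (list_degree l) \<omega> (Suc i) = l' ! i}"
      have [measurable]: "B k \<in> measurable ?G (count_space UNIV)" if "k \<in> {1..m'}" for k
        using that by (intro B_generated) (auto simp: past_def)
      have [measurable]: "dM (Suc n) \<in> measurable ?G (count_space UNIV)"
        by (intro dM_generated) (auto simp: past_def)
      have [measurable]: "(\<lambda>\<omega>. degree_step \<theta> \<delta> T B m m' (length l) (list_degree l) \<omega> v) \<in> measurable ?G (count_space UNIV)" for v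
        by (rule degree_step_generated) simp
      have E1: "?E1 \<in> sets ?G"
        using sets_generated_mono[OF past_mono Suc.IH] mm by (simp add: m_def)
      have "{\<omega> \<in> space ?G. m + dM (Suc n) \<omega> = m'} \<in> sets ?G" by measurable
      then have E2: "?E2 \<in> sets ?G" by simp
      have "{\<omega> \<in> space ?G. 1 + (\<Sum>k=1..m'. real (B k \<omega>)) = real (length l')} \<in> sets ?G" by measurable
      moreover have "1 + (\<Sum>k=1..m'. real (B k \<omega>)) = real (length l') \<longleftrightarrow> node_count B m' \<omega> = length l'" for \<omega>
        unfolding real_node_count[symmetric] by simp
      ultimately have E3: "?E3 \<in> sets ?G" by simp
      have "{\<omega> \<in> space ?G. \<forall>i\<in>{..<length l'}. degree_step \<theta> \<delta> T B m m' (length l) (list_degree l) \<omega> (Suc i) = l' ! i} \<in> sets ?G"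
        by measurable
      then have E4: "?E4 \<in> sets ?G" by (simp only: space_generated)
      \<comment> \<open>Once the history is h0, the new entry is a condition on the next batch and,
        with m and m' constant, on coins and clocks of edges up to m'.\<close>
      have "hist (Suc n) \<omega> = h \<longleftrightarrow> hist n \<omega> = h0 \<and> m + dM (Suc n) \<omega> = m' \<and> node_count B m' \<omega> = length l' \<and>
        (\<forall>i\<in>{..<length l'}. degree_step \<theta> \<delta> T B m m' (length l) (list_degree l) \<omega> (Suc i) = l' ! i)" for \<omega>
      proof (cases "hist n \<omega> = h0")
        case True
        have "edges n \<omega> = m" "list_degree l = deg n \<omega>" "length l = node_count B (edges n \<omega>) \<omega>"
          using hist_nth[OF True order_refl] last len by simp_all
        note last_step = this
        have "hist (Suc n) \<omega> = h \<longleftrightarrow>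
            edges (Suc n) \<omega> = m' \<and> map (deg (Suc n) \<omega>) [1..<Suc (node_count B (edges (Suc n) \<omega>) \<omega>)] = l'"
          using True by (simp add: hist_Suc h del: upt_Suc)
        also have "\<dots> \<longleftrightarrow> edges (Suc n) \<omega> = m' \<and> node_count B m' \<omega> = length l' \<and>
            (\<forall>i\<in>{..<length l'}. deg (Suc n) \<omega> (Suc i) = l' ! i)"
          unfolding map_upt_eq_iff by auto
        also have "\<dots> \<longleftrightarrow> edges (Suc n) \<omega> = m' \<and> node_count B m' \<omega> = length l' \<and>
            (\<forall>i\<in>{..<length l'}. degree_step \<theta> \<delta> T B m m' (length l) (list_degree l) \<omega> (Suc i) = l' ! i)"
          using last_step by auto
        finally show ?thesis
          using True last_step(1) by (simp add: edge_count_Suc)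
      qed (auto simp: hist_Suc h)
      then have "{\<omega> \<in> space M. hist (Suc n) \<omega> = h} = ?E1 \<inter> ?E2 \<inter> ?E3 \<inter> ?E4" by auto
      also have "\<dots> \<in> sets ?G" using E1 E2 E3 E4 by (intro sets.Int)
      finally show ?thesis by (simp add: h)
    next
      \<comment> \<open>Edge counts never decrease, so such an h is not attained.\<close>
      case False
      have "hist (Suc n) \<omega> \<noteq> h" for \<omega>
      proof
        assume *: "hist (Suc n) \<omega> = h"
        then have h0: "hist n \<omega> = h0" and m': "edges (Suc n) \<omega> = m'" by (auto simp: hist_Suc h)
        have "m = edges n \<omega>"
          using hist_nth(1)[OF h0 order_refl] last by simp
        then show False using m' False by (simp add: edge_count_Suc)
      qed
      then have "{\<omega> \<in> space M. hist (Suc n) \<omega> = h} = {}" by auto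
      then show ?thesis by (simp only: sets.empty_sets)
    qed
  qed
qed

lemma hist_measurable: "hist n \<in> measurable M (count_space UNIV)"
  using src_events[OF past_subset hist_generated[of n]]
  by (auto intro!: measurableI simp: measurable_count_space_eq_countable vimage_def Int_def conj_commute)

end

section \<open>Batch sizes\<close>

lemma nn_integral_partition:
  fixes H :: "'a \<Rightarrow> nat"
  assumes [measurable]: "H \<in> measurable M (count_space UNIV)" "f \<in> borel_measurable M"
  shows "(\<integral>\<^sup>+\<omega>. f \<omega> \<partial>M) = (\<Sum>k. \<integral>\<^sup>+\<omega>. f \<omega> * indicator {\<omega> \<in> space M. H \<omega> = k} \<omega> \<partial>M)"
proof -
  have "(\<integral>\<^sup>+\<omega>. f \<omega> \<partial>M) = (\<integral>\<^sup>+\<omega>. (\<Sum>k. f \<omega> * indicator {\<omega> \<in> space M. H \<omega> = k} \<omega>) \<partial>M)"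
  proof (rule nn_integral_cong)
    fix \<omega> assume "\<omega> \<in> space M"
    then have "(\<Sum>k. f \<omega> * indicator {\<omega> \<in> space M. H \<omega> = k} \<omega>)
        = (\<Sum>k\<in>{H \<omega>}. f \<omega> * indicator {\<omega> \<in> space M. H \<omega> = k} \<omega>)"
      by (intro suminf_finite) auto
    then show "f \<omega> = (\<Sum>k. f \<omega> * indicator {\<omega> \<in> space M. H \<omega> = k} \<omega>)"
      using \<open>\<omega> \<in> space M\<close> by simp
  qed
  also have "\<dots> = (\<Sum>k. \<integral>\<^sup>+\<omega>. f \<omega> * indicator {\<omega> \<in> space M. H \<omega> = k} \<omega> \<partial>M)"
    by (intro nn_integral_suminf) measurable
  finally show ?thesis .
qed

text \<open>Takes the place of conditioning on a discrete variable: the integral is a countable sum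
  over the values of H, numbered by \<open>to_nat\<close>.\<close>

lemma nn_integral_eq_on_partition:
  fixes H :: "'a \<Rightarrow> 'b :: countable"
  assumes [measurable]: "H \<in> measurable M (count_space UNIV)" "f \<in> borel_measurable M" "g \<in> borel_measurable M"
    and eq: "\<And>h. (\<integral>\<^sup>+\<omega>. f \<omega> * indicator {\<omega> \<in> space M. H \<omega> = h} \<omega> \<partial>M)
      = (\<integral>\<^sup>+\<omega>. g \<omega> * indicator {\<omega> \<in> space M. H \<omega> = h} \<omega> \<partial>M)"
  shows "(\<integral>\<^sup>+\<omega>. f \<omega> \<partial>M) = (\<integral>\<^sup>+\<omega>. g \<omega> \<partial>M)"
proof -
  have *: "(\<integral>\<^sup>+\<omega>. f \<omega> * indicator {\<omega> \<in> space M. to_nat (H \<omega>) = k} \<omega> \<partial>M)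
      = (\<integral>\<^sup>+\<omega>. g \<omega> * indicator {\<omega> \<in> space M. to_nat (H \<omega>) = k} \<omega> \<partial>M)" for k
  proof (cases "\<exists>h. to_nat (h :: 'b) = k")
    case True
    then obtain h :: 'b where "k = to_nat h" by auto
    then show ?thesis using eq[of h] by simp
  next
    case False
    then have "{\<omega> \<in> space M. to_nat (H \<omega>) = k} = {}" by auto
    then show ?thesis by simp
  qed
  have m: "(\<lambda>\<omega>. to_nat (H \<omega>)) \<in> measurable M (count_space UNIV)" by measurable
  show ?thesis
    unfolding nn_integral_partition[OF m assms(2)] nn_integral_partition[OF m assms(3)]
    by (intro suminf_cong) (rule *)
qed

lemma sums_exp_fact: "(\<lambda>j. x ^ j / fact j) sums exp (x :: real)"
  using exp_converges[of x] by (simp add: scaleR_conv_of_real divide_inverse mult.commute)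

text \<open>Cancelling j against j! shifts the index by one and leaves x times the exponential
  series; the second moment below uses the same shift.\<close>

lemma sums_poisson_mean: "(\<lambda>j. real j * (x ^ j / fact j)) sums (x * exp x)"
proof -
  from sums_mult[OF sums_exp_fact, of x x]
  have "(\<lambda>j. real (Suc j) * (x ^ Suc j / fact (Suc j))) sums (x * exp x)"
    by (simp add: ac_simps del: of_nat_Suc)
  from sums_Suc[OF this] show ?thesis by simp
qed

lemma sums_poisson_square: "(\<lambda>j. (real j)\<^sup>2 * (x ^ j / fact j)) sums ((x\<^sup>2 + x) * exp x)"
proof -
  from sums_mult[OF sums_add[OF sums_poisson_mean[of x] sums_exp_fact], of x]
  have "(\<lambda>j. x * (real j * (x ^ j / fact j) + x ^ j / fact j)) sums (x * (x * exp x + exp x))" .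
  also have "(\<lambda>j. x * (real j * (x ^ j / fact j) + x ^ j / fact j))
      = (\<lambda>j. real (Suc j) * (x * (x ^ j / fact j)))"
    by (rule ext) (simp add: algebra_simps add_divide_distrib)
  also have "\<dots> = (\<lambda>j. (real (Suc j))\<^sup>2 * (x ^ Suc j / fact (Suc j)))"
    by (rule ext) (simp add: power2_eq_square del: of_nat_Suc)
  finally have "(\<lambda>j. (real (Suc j))\<^sup>2 * (x ^ Suc j / fact (Suc j))) sums (x * (x * exp x + exp x))" .
  from sums_Suc[OF this] show ?thesis by (simp add: algebra_simps power2_eq_square)
qed

context pa_driving
begin

lemma nn_integral_dM:
  assumes k: "k \<ge> 1" and f: "\<And>j. 0 \<le> f j"
  shows "(\<integral>\<^sup>+\<omega>. ennreal (f (dM k \<omega>)) \<partial>M) = (\<Sum>j. ennreal (f j * prob {\<omega> \<in> space M. dM k \<omega> = j}))"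
proof -
  have [measurable]: "dM k \<in> measurable M (count_space UNIV)" using dM_rv[OF k] .
  have "(\<integral>\<^sup>+\<omega>. ennreal (f (dM k \<omega>)) \<partial>M)
      = (\<Sum>j. \<integral>\<^sup>+\<omega>. ennreal (f (dM k \<omega>)) * indicator {\<omega> \<in> space M. dM k \<omega> = j} \<omega> \<partial>M)"
    using nn_integral_partition[of "dM k" M "\<lambda>\<omega>. ennreal (f (dM k \<omega>))"] by simp
  also have "\<dots> = (\<Sum>j. \<integral>\<^sup>+\<omega>. ennreal (f j) * indicator {\<omega> \<in> space M. dM k \<omega> = j} \<omega> \<partial>M)"
    by (intro suminf_cong nn_integral_cong) (auto split: split_indicator)
  also have "\<dots> = (\<Sum>j. ennreal (f j * prob {\<omega> \<in> space M. dM k \<omega> = j}))"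
    by (simp add: nn_integral_cmult_indicator emeasure_eq_measure ennreal_mult f)
  finally show ?thesis .
qed

lemma sums_law_dM:
  assumes k: "k \<ge> 1"
    and s: "(\<lambda>j. f (Suc j) * (lam ^ j / fact j)) sums s"
  shows "(\<lambda>j. f (Suc j) * prob {\<omega> \<in> space M. dM k \<omega> = Suc j}) sums (exp (- lam) * s)"
proof -
  have "prob {\<omega> \<in> space M. dM k \<omega> = Suc j} = exp (- lam) * lam ^ j / fact j" for j
    using dM_law[OF k, of "Suc j"] by simp
  then show ?thesis
    using sums_mult[OF s, of "exp (- lam)"] by (simp add: ac_simps)
qed

text \<open>The law is prescribed for j \<ge> 1 only, but those masses form a full exponential
  series and already sum to 1.\<close>

lemma prob_dM_0:
  assumes k: "k \<ge> 1"
  shows "prob {\<omega> \<in> space M. dM k \<omega> = 0} = 0"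
proof -
  let ?P = "\<lambda>j. prob {\<omega> \<in> space M. dM k \<omega> = j}"
  have 1: "(\<lambda>j. ?P (Suc j)) sums 1"
    using sums_law_dM[OF k, of "\<lambda>_. 1" "exp lam"] sums_exp_fact[of lam] by (simp add: exp_add[symmetric])
  then have "?P sums (1 + ?P 0)" by (rule sums_Suc)
  then have "(\<Sum>j. ennreal (?P j)) = ennreal (1 + ?P 0)"
    by (intro suminf_ennreal_eq) auto
  moreover have "(\<integral>\<^sup>+\<omega>. ennreal 1 \<partial>M) = (\<Sum>j. ennreal (1 * ?P j))"
    by (rule nn_integral_dM[OF k, of "\<lambda>_. 1"]) simp
  ultimately have "ennreal (1 + ?P 0) = ennreal 1"
    by (simp only: mult_1_left nn_integral_const emeasure_space_1 mult_1_right)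
  moreover have "0 \<le> 1 + ?P 0" by (rule add_nonneg_nonneg) auto
  ultimately have "1 + ?P 0 = 1" by (subst (asm) ennreal_inj) auto
  then show ?thesis by linarith
qed

text \<open>A batch is one plus a Poisson variable, whence the argument \<open>Suc j\<close>; the
  value at 0 carries no mass.\<close>

lemma has_moment_dM:
  assumes k: "k \<ge> 1" and f: "\<And>j. 0 \<le> f j"
    and s: "(\<lambda>j. f (Suc j) * (lam ^ j / fact j)) sums s"
  shows "integrable M (\<lambda>\<omega>. f (dM k \<omega>))" "expectation (\<lambda>\<omega>. f (dM k \<omega>)) = exp (- lam) * s"
proof -
  have [measurable]: "dM k \<in> measurable M (count_space UNIV)" using dM_rv[OF k] .
  have S: "(\<lambda>j. f j * prob {\<omega> \<in> space M. dM k \<omega> = j}) sums (exp (- lam) * s)"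
    using sums_Suc[OF sums_law_dM[OF k s]] prob_dM_0[OF k] by simp
  have nn: "(\<integral>\<^sup>+\<omega>. ennreal (f (dM k \<omega>)) \<partial>M) = ennreal (exp (- lam) * s)"
    unfolding nn_integral_dM[of k f, OF k f] by (rule suminf_ennreal_eq[OF _ S]) (simp add: f)
  have s0: "0 \<le> exp (- lam) * s"
    unfolding sums_unique[OF S] by (intro suminf_nonneg sums_summable[OF S] mult_nonneg_nonneg f measure_nonneg)
  show *: "integrable M (\<lambda>\<omega>. f (dM k \<omega>))"
    by (rule integrableI_nonneg) (auto simp: nn f)
  show "expectation (\<lambda>\<omega>. f (dM k \<omega>)) = exp (- lam) * s"
    using nn nn_integral_eq_integral[OF *] f s0 by (simp add: integral_nonneg)
qed

text \<open>With N Poisson of mean \<open>lam\<close>, the second moment of 1 + N is 1 + 2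
  \<open>lam\<close> plus the second moment \<open>lam\<^sup>2 + lam\<close> of N.\<close>

lemma integrable_dM: "k \<ge> 1 \<Longrightarrow> integrable M (\<lambda>\<omega>. real (dM k \<omega>))"
  and expectation_dM: "k \<ge> 1 \<Longrightarrow> expectation (\<lambda>\<omega>. real (dM k \<omega>)) = lam + 1"
  and integrable_dM_square: "k \<ge> 1 \<Longrightarrow> integrable M (\<lambda>\<omega>. (real (dM k \<omega>))\<^sup>2)"
  and expectation_dM_square: "k \<ge> 1 \<Longrightarrow> expectation (\<lambda>\<omega>. (real (dM k \<omega>))\<^sup>2) = lam\<^sup>2 + 3 * lam + 1"
proof -
  assume k: "k \<ge> 1"
  have 1: "(\<lambda>j. real (Suc j) * (lam ^ j / fact j)) sums ((lam + 1) * exp lam)"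
    using sums_add[OF sums_poisson_mean[of lam] sums_exp_fact[of lam]] by (simp add: algebra_simps add_divide_distrib)
  have "(\<lambda>j. (real (Suc j))\<^sup>2 * (lam ^ j / fact j))
      = (\<lambda>j. (real j)\<^sup>2 * (lam ^ j / fact j) + 2 * (real j * (lam ^ j / fact j)) + lam ^ j / fact j)"
    by (rule ext) (simp add: power2_eq_square algebra_simps add_divide_distrib)
  then have "(\<lambda>j. (real (Suc j))\<^sup>2 * (lam ^ j / fact j)) sums ((lam\<^sup>2 + lam) * exp lam + 2 * (lam * exp lam) + exp lam)"
    by (simp only:) (intro sums_add sums_mult sums_poisson_square sums_poisson_mean sums_exp_fact)
  then have 2: "(\<lambda>j. (real (Suc j))\<^sup>2 * (lam ^ j / fact j)) sums ((lam\<^sup>2 + 3 * lam + 1) * exp lam)"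
    by (simp add: algebra_simps)
  have e: "exp (- lam) * (x * exp lam) = x" for x
    by (simp add: exp_minus)
  show "integrable M (\<lambda>\<omega>. real (dM k \<omega>))" "expectation (\<lambda>\<omega>. real (dM k \<omega>)) = lam + 1"
    using has_moment_dM[OF k _ 1] by (simp_all add: e)
  show "integrable M (\<lambda>\<omega>. (real (dM k \<omega>))\<^sup>2)" "expectation (\<lambda>\<omega>. (real (dM k \<omega>))\<^sup>2) = lam\<^sup>2 + 3 * lam + 1"
    using has_moment_dM[of k "\<lambda>j. (real j)\<^sup>2", OF k _ 2] by (simp_all add: e)
qed

lemma AE_dM_ge_1: "AE \<omega> in M. \<forall>k\<ge>1. dM k \<omega> \<ge> 1"
proof -
  have "AE \<omega> in M. k \<ge> 1 \<longrightarrow> dM k \<omega> \<ge> 1" for k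
  proof (cases "k \<ge> 1")
    case True
    have [measurable]: "dM k \<in> measurable M (count_space UNIV)" using dM_rv[OF True] .
    have "AE \<omega> in M. \<not> dM k \<omega> = 0"
      using prob_dM_0[OF True] by (subst (asm) prob_eq_0) auto
    then show ?thesis by eventually_elim auto
  qed simp
  then show ?thesis by (simp add: AE_all_countable)
qed

text \<open>The mean as a sum of tails. In this form the random number of edges enters a step: edge
  j of the batch exists exactly when j is below the batch size.\<close>

lemma suminf_tail_dM:
  assumes k: "k \<ge> 1" and lam: "0 < lam"
  shows "(\<Sum>j. ennreal (prob {\<omega> \<in> space M. j < dM k \<omega>})) = ennreal (lam + 1)"
proof -
  have [measurable]: "dM k \<in> measurable M (count_space UNIV)" using dM_rv[OF k] .
  have "ennreal (lam + 1) = (\<integral>\<^sup>+\<omega>. ennreal (real (dM k \<omega>)) \<partial>M)"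
    using nn_integral_eq_integral[OF integrable_dM[OF k]] expectation_dM[OF k] by simp
  also have "\<dots> = (\<integral>\<^sup>+\<omega>. (\<Sum>j. indicator {\<omega> \<in> space M. j < dM k \<omega>} \<omega>) \<partial>M)"
  proof (rule nn_integral_cong)
    fix \<omega> assume "\<omega> \<in> space M"
    then have "(\<Sum>j. indicator {\<omega> \<in> space M. j < dM k \<omega>} \<omega> :: ennreal)
        = (\<Sum>j<dM k \<omega>. indicator {\<omega> \<in> space M. j < dM k \<omega>} \<omega>)"
      by (intro suminf_finite) auto
    also have "\<dots> = (\<Sum>j<dM k \<omega>. 1)"
      using \<open>\<omega> \<in> space M\<close> by (intro sum.cong) auto
    finally show "ennreal (real (dM k \<omega>)) = (\<Sum>j. indicator {\<omega> \<in> space M. j < dM k \<omega>} \<omega>)"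
      by (simp add: ennreal_of_nat_eq_real_of_nat)
  qed
  also have "\<dots> = (\<Sum>j. \<integral>\<^sup>+\<omega>. indicator {\<omega> \<in> space M. j < dM k \<omega>} \<omega> \<partial>M)"
    by (intro nn_integral_suminf) measurable
  also have "\<dots> = (\<Sum>j. ennreal (prob {\<omega> \<in> space M. j < dM k \<omega>}))"
    by (simp add: emeasure_eq_measure)
  finally show ?thesis ..
qed

end

section \<open>The martingale\<close>

context pa_degree_process
begin

text \<open>Mean batch size times the probability that an edge counts for an already existing
  node.\<close>

definition rate :: real where
  "rate = (lam + 1) * (1 - real \<theta> * p)"

text \<open>By \<open>sum_degree\<close> this is the total of degree plus \<delta> over all nodes,
  that is, the denominator of the attachment probabilities.\<close>

definition weight :: "nat \<Rightarrow> nat \<Rightarrow> real" where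
  "weight m N = real m + 1 + \<delta> * real N"

lemma weight_pos: "0 < weight m N"
  using \<delta> by (simp add: weight_def add_pos_nonneg)

lemma rate_pos: "0 < rate"
proof -
  have "real \<theta> * p \<le> 1 * p" using \<theta> p by (intro mult_right_mono) auto
  then show ?thesis using lam p unfolding rate_def by (intro mult_pos_pos) linarith+
qed

text \<open>Newborn labels exceed all current labels, so only chosen endpoints remain. Reindexing
  from 0 detaches the position in the batch from the random edge count.\<close>

lemma deg_Suc_old_node:
  assumes v: "v \<in> {1..node_count B (edges n \<omega>) \<omega>}"
  shows "deg (Suc n) \<omega> v = deg n \<omega> v + (\<Sum>j<dM (Suc n) \<omega>.
      of_bool (1 - \<theta> * B (edges n \<omega> + 1 + j) \<omega> = 1 \<and>
        attach \<delta> (deg n \<omega>) {1..node_count B (edges n \<omega>) \<omega>} (\<lambda>u. T (edges n \<omega> + 1 + j) u \<omega>) = v))"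
proof -
  let ?m = "edges n \<omega>" and ?m' = "edges (Suc n) \<omega>"
  \<comment> \<open>If coin k is nonzero, the newborn label strictly exceeds the node count after k
    - 1 edges, which is at least the current one.\<close>
  have new: "B k \<omega> * of_bool (1 + (\<Sum>j=1..k. B j \<omega>) = v) = 0" if k: "k \<in> {?m + 1..?m'}" for k
  proof (cases "B k \<omega> = 0")
    case False
    obtain i where i: "k = Suc i" "?m \<le> i" using k by (cases k) auto
    have "v \<le> node_count B i \<omega>"
      using v node_count_mono[OF i(2), of B \<omega>] by simp
    then have "v < 1 + (\<Sum>j=1..k. B j \<omega>)"
      using False by (simp add: node_count_def i)
    then show ?thesis by simp
  qed simp
  \<comment> \<open>Truncated subtraction leaves only 0 or 1 as the coefficient.\<close>
  have unit: "(1 - x) * of_bool Q = of_bool (1 - x = 1 \<and> Q)" for x :: nat and Q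
    by (cases "x = 0") auto
  have "deg (Suc n) \<omega> v = deg n \<omega> v + (\<Sum>k = ?m + 1..?m'.
      of_bool (1 - \<theta> * B k \<omega> = 1 \<and> attach \<delta> (deg n \<omega>) {1..node_count B ?m \<omega>} (\<lambda>u. T k u \<omega>) = v))"
    unfolding pa_degree.simps degree_step_def mult.assoc[of \<theta>] unit
    by (intro arg_cong2[where f = "(+)"] sum.cong refl)
      (simp only: new mult_zero_right add_0_right eq_commute[of v])
  also have "{?m + 1..?m'} = (\<lambda>j. ?m + 1 + j) ` {..<dM (Suc n) \<omega>}"
    by (auto simp: edge_count_Suc image_iff intro: bexI[of _ "_ - (?m + 1)"] )
      (metis add_Suc add_less_cancel_left le_Suc_ex lessThan_iff less_Suc_eq_le)
  finally show ?thesis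
    by (subst (asm) sum.reindex) (auto simp: inj_on_def)
qed

lemma prob_coin:
  assumes k: "k \<ge> 1"
  shows "prob {\<omega> \<in> space M. 1 - \<theta> * B k \<omega> = 1} = 1 - real \<theta> * p"
proof (cases "\<theta> = 0")
  case True then show ?thesis by (simp add: prob_space)
next
  case False
  with \<theta> have [simp]: "\<theta> = 1" by simp
  have "{\<omega> \<in> space M. 1 - \<theta> * B k \<omega> = 1} = {\<omega> \<in> space M. B k \<omega> = 0}" by auto
  then show ?thesis using B_zero[OF k] by simp
qed

text \<open>
  Given the history, the batch size, the coin and the clocks of a new edge involve disjoint sets of
  sources.
\<close>

lemma prob_edge_to:
  fixes h
  defines "m \<equiv> fst (last h)" and "l \<equiv> snd (last h)"
  assumes v: "v \<in> {1..length l}" and sum: "(\<Sum>u=1..length l. list_degree l u) = m + 1"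
  shows "prob ({\<omega> \<in> space M. hist n \<omega> = h} \<inter> {\<omega> \<in> space M. j < dM (Suc n) \<omega>} \<inter>
      ({\<omega> \<in> space M. 1 - \<theta> * B (m + 1 + j) \<omega> = 1} \<inter>
       {\<omega> \<in> space M. attach \<delta> (list_degree l) {1..length l} (\<lambda>u. T (m + 1 + j) u \<omega>) = v}))
    = prob {\<omega> \<in> space M. hist n \<omega> = h} * prob {\<omega> \<in> space M. j < dM (Suc n) \<omega>} *
      ((1 - real \<theta> * p) * ((real (list_degree l v) + \<delta>) / weight m (length l)))"
proof -
  let ?E = "{\<omega> \<in> space M. hist n \<omega> = h}" and ?D = "{\<omega> \<in> space M. j < dM (Suc n) \<omega>}"
    and ?C = "{\<omega> \<in> space M. 1 - \<theta> * B (m + 1 + j) \<omega> = 1}"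
    and ?A = "{\<omega> \<in> space M. attach \<delta> (list_degree l) {1..length l} (\<lambda>u. T (m + 1 + j) u \<omega>) = v}"
  let ?clocks = "clock (m + 1 + j) ` {1..}"
  have sub: "past n m \<subseteq> sources" "{Batch (Suc n)} \<subseteq> sources" "{Coin (m + 1 + j)} \<subseteq> sources" "?clocks \<subseteq> sources"
    using past_subset clock by (auto simp: sources_def)
  have E: "?E \<in> sets (generated src (past n m))"
    using hist_generated[of n h] by (simp add: m_def)
  have D: "?D \<in> sets (generated src {Batch (Suc n)})"
  proof -
    have [measurable]: "dM (Suc n) \<in> measurable (generated src {Batch (Suc n)}) (count_space UNIV)"
      by (intro dM_generated) simp
    have "{\<omega> \<in> space (generated src {Batch (Suc n)}). j < dM (Suc n) \<omega>} \<in> sets (generated src {Batch (Suc n)})"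
      by measurable
    then show ?thesis by simp
  qed
  have C: "?C \<in> sets (generated src {Coin (m + 1 + j)})"
  proof -
    have [measurable]: "B (m + 1 + j) \<in> measurable (generated src {Coin (m + 1 + j)}) (count_space UNIV)"
      by (intro B_generated) simp
    have "{\<omega> \<in> space (generated src {Coin (m + 1 + j)}). 1 - \<theta> * B (m + 1 + j) \<omega> = 1}
        \<in> sets (generated src {Coin (m + 1 + j)})"
      by measurable
    then show ?thesis by (simp only: space_generated)
  qed
  have A: "?A \<in> sets (generated src ?clocks)"
    by (rule attach_generated) auto
  have ED: "?E \<inter> ?D \<in> sets (generated src (past n m \<union> {Batch (Suc n)}))"
    by (intro sets.Int sets_generated_mono[OF _ E] sets_generated_mono[OF _ D]) auto
  have CA: "?C \<inter> ?A \<in> sets (generated src ({Coin (m + 1 + j)} \<union> ?clocks))"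
    by (intro sets.Int sets_generated_mono[OF _ C] sets_generated_mono[OF _ A]) auto
  have "prob (?E \<inter> ?D \<inter> (?C \<inter> ?A)) = prob (?E \<inter> ?D) * prob (?C \<inter> ?A)"
    by (rule prob_Int_src[OF _ _ _ ED CA]) (use sub clock in \<open>auto simp: past_def\<close>)
  also have "prob (?E \<inter> ?D) = prob ?E * prob ?D"
    by (rule prob_Int_src[OF _ _ _ E D]) (use sub in \<open>auto simp: past_def\<close>)
  also have "prob (?C \<inter> ?A) = prob ?C * prob ?A"
    by (rule prob_Int_src[OF _ _ _ C A]) (use sub clock in auto)
  also have "prob ?C = 1 - real \<theta> * p"
    by (rule prob_coin) simp
  also have "prob ?A = (real (list_degree l v) + \<delta>) / (\<Sum>u=1..length l. real (list_degree l u) + \<delta>)"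
    by (rule prob_attach) (use v in auto)
  also have "(\<Sum>u=1..length l. real (list_degree l u) + \<delta>) = weight m (length l)"
  proof -
    have "(\<Sum>u=1..length l. real (list_degree l u) + \<delta>) = real (\<Sum>u=1..length l. list_degree l u) + \<delta> * real (length l)"
      by (simp add: sum.distrib)
    then show ?thesis unfolding sum by (simp add: weight_def)
  qed
  finally show ?thesis .
qed

lemma AE_sum_deg: "AE \<omega> in M. \<forall>n. (\<Sum>u=1..node_count B (edges n \<omega>) \<omega>. deg n \<omega> u) = edges n \<omega> + 1"
  using AE_B_le_1
proof eventually_elim
  case (elim \<omega>)
  then show ?case by (intro allI sum_degree \<theta>) blast
qed

lemma edges_measurable [measurable]: "edges n \<in> measurable M (count_space UNIV)"
proof -
  have "edges n = (\<lambda>\<omega>. fst (hist n \<omega> ! n))"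
    using hist_nth(1)[OF refl, of n n] by auto
  then show ?thesis using measurable_compose[OF hist_measurable, of "\<lambda>h. fst (h ! n)" "count_space UNIV" n] by simp
qed

text \<open>The coin sum has a random upper limit; the history is already known to be measurable,
  and the count can be read off it.\<close>

lemma nodes_measurable [measurable]: "(\<lambda>\<omega>. node_count B (edges n \<omega>) \<omega>) \<in> measurable M (count_space UNIV)"
proof -
  have "(\<lambda>\<omega>. node_count B (edges n \<omega>) \<omega>) = (\<lambda>\<omega>. length (snd (hist n \<omega> ! n)))"
    using hist_nth(2)[OF refl, of n n] by auto
  then show ?thesis using measurable_compose[OF hist_measurable, of "\<lambda>h. length (snd (h ! n))" "count_space UNIV" n] by simp
qed

lemma deg_measurable [measurable]: "(\<lambda>\<omega>. deg n \<omega> v) \<in> measurable M (count_space UNIV)"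
proof -
  have "(\<lambda>\<omega>. deg n \<omega> v) = (\<lambda>\<omega>. list_degree (snd (hist n \<omega> ! n)) v)"
    using hist_nth(3)[OF refl, of n n] by auto
  then show ?thesis using measurable_compose[OF hist_measurable, of "\<lambda>h. list_degree (snd (h ! n)) v" "count_space UNIV" n] by simp
qed

text \<open>Every edge of the batch raises the degree of v with probability (1 - \<theta> p) (d +
  \<delta>) / w, independently of its presence in the batch and of the history. Summing the presence
  probabilities gives the factor \<lambda> + 1, so the mean is again a multiple of d +
  \<delta>.\<close>

lemma one_step:
  fixes h
  defines "m \<equiv> fst (last h)" and "l \<equiv> snd (last h)"
  assumes v: "v \<in> {1..length l}"
  shows "(\<integral>\<^sup>+\<omega>. ennreal (real (deg (Suc n) \<omega> v) + \<delta>) * indicator {\<omega> \<in> space M. hist n \<omega> = h} \<omega> \<partial>M)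
    = ennreal ((real (list_degree l v) + \<delta>) * (1 + rate / weight m (length l))) * emeasure M {\<omega> \<in> space M. hist n \<omega> = h}"
proof -
  let ?E = "{\<omega> \<in> space M. hist n \<omega> = h}"
  note [measurable] = hist_measurable[of n]
  have at_last: "edges n \<omega> = m" "node_count B m \<omega> = length l" "deg n \<omega> = list_degree l" if "hist n \<omega> = h" for \<omega>
  proof -
    have "h ! n = last h" using length_hist[of n \<omega>] that by (metis last_conv_nth diff_Suc_1 list.size(3) nat.distinct(1))
    then show "edges n \<omega> = m" "node_count B m \<omega> = length l" "deg n \<omega> = list_degree l"
      using hist_nth[OF that order_refl] by (auto simp: m_def l_def)
  qed
  show ?thesis
  proof (cases "(\<Sum>u=1..length l. list_degree l u) = m + 1")
    \<comment> \<open>The degree sum of h can be off only where some coin exceeds 1, so the atom is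
      a null set and both sides vanish.\<close>
    case False
    have "AE \<omega> in M. \<omega> \<notin> ?E"
      using AE_sum_deg
    proof eventually_elim
      case (elim \<omega>)
      show ?case
      proof
        assume "\<omega> \<in> ?E"
        then have "hist n \<omega> = h" by simp
        from elim[rule_format, of n] False show False by (simp only: at_last[OF \<open>hist n \<omega> = h\<close>])
      qed
    qed
    then have AE0: "AE \<omega> in M. indicator ?E \<omega> = (0::ennreal)"
      by eventually_elim (auto simp: indicator_def)
    have "(\<integral>\<^sup>+\<omega>. ennreal (real (deg (Suc n) \<omega> v) + \<delta>) * indicator ?E \<omega> \<partial>M) = (\<integral>\<^sup>+\<omega>. 0 \<partial>M)"
      using AE0 by (intro nn_integral_cong_AE) auto
    moreover have "emeasure M ?E = 0"
      using \<open>AE \<omega> in M. \<omega> \<notin> ?E\<close> by (intro AE_iff_measurable[THEN iffD1, rotated -1]) auto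
    ultimately show ?thesis by simp
  next
    case True
    let ?S = "\<lambda>j. ?E \<inter> {\<omega> \<in> space M. j < dM (Suc n) \<omega>} \<inter> ({\<omega> \<in> space M. 1 - \<theta> * B (m + 1 + j) \<omega> = 1} \<inter>
       {\<omega> \<in> space M. attach \<delta> (list_degree l) {1..length l} (\<lambda>u. T (m + 1 + j) u \<omega>) = v})"
    let ?q = "(1 - real \<theta> * p) * ((real (list_degree l v) + \<delta>) / weight m (length l))"
    have q0: "0 \<le> ?q"
      using rate_pos lam \<delta> weight_pos[of m "length l"] by (simp add: rate_def zero_less_mult_iff)
    have S: "?S j \<in> sets M" for j
    proof -
      have [measurable]: "dM (Suc n) \<in> measurable M (count_space UNIV)" "B (m + 1 + j) \<in> measurable M (count_space UNIV)"
        using dM_rv[of "Suc n"] B_rv[of "m + 1 + j"] by auto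
      have A: "{\<omega> \<in> space M. attach \<delta> (list_degree l) {1..length l} (\<lambda>u. T (m + 1 + j) u \<omega>) = v} \<in> sets M"
        by (rule src_events[OF _ attach_generated[where A = "clock (m + 1 + j) ` {1..}"]])
          (use clock in \<open>auto simp: sources_def\<close>)
      have "?E \<in> sets M" "{\<omega> \<in> space M. j < dM (Suc n) \<omega>} \<in> sets M" "{\<omega> \<in> space M. 1 - \<theta> * B (m + 1 + j) \<omega> = 1} \<in> sets M"
        by measurable
      with A show ?thesis by (intro sets.Int)
    qed
    have prob_S: "ennreal (prob (?S j)) = ennreal (prob ?E * ?q) * ennreal (prob {\<omega> \<in> space M. j < dM (Suc n) \<omega>})" for j
    proof -
      have "prob (?S j) = prob ?E * prob {\<omega> \<in> space M. j < dM (Suc n) \<omega>} * ?q"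
        using v True unfolding m_def l_def by (rule prob_edge_to)
      also have "\<dots> = prob ?E * ?q * prob {\<omega> \<in> space M. j < dM (Suc n) \<omega>}"
        by (simp only: ac_simps)
      finally show ?thesis
        by (simp only: ennreal_mult[OF mult_nonneg_nonneg[OF measure_nonneg q0] measure_nonneg])
    qed
    \<comment> \<open>The batch of random size is written as an infinite series of indicators: an
      edge beyond the batch contributes 0.\<close>
    have pointwise: "ennreal (real (deg (Suc n) \<omega> v) + \<delta>) * indicator ?E \<omega>
        = ennreal (real (list_degree l v) + \<delta>) * indicator ?E \<omega> + (\<Sum>j. indicator (?S j) \<omega>)"
      if "\<omega> \<in> space M" for \<omega>
    proof (cases "\<omega> \<in> ?E")
      case E: True
      then have hE: "hist n \<omega> = h" by simp
      note at = at_last[OF hE]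
      let ?b = "\<lambda>j. of_bool (1 - \<theta> * B (m + 1 + j) \<omega> = 1 \<and>
        attach \<delta> (list_degree l) {1..length l} (\<lambda>u. T (m + 1 + j) u \<omega>) = v)"
      have "(\<Sum>j. indicator (?S j) \<omega> :: ennreal) = (\<Sum>j<dM (Suc n) \<omega>. indicator (?S j) \<omega>)"
        by (intro suminf_finite) auto
      also have "\<dots> = (\<Sum>j<dM (Suc n) \<omega>. ennreal (real (?b j)))"
        using E by (intro sum.cong refl) (auto simp: indicator_def)
      also have "\<dots> = ennreal (real (\<Sum>j<dM (Suc n) \<omega>. ?b j))"
        unfolding of_nat_sum by (rule sum_ennreal) simp
      finally have S_eq: "(\<Sum>j. indicator (?S j) \<omega> :: ennreal) = ennreal (real (\<Sum>j<dM (Suc n) \<omega>. ?b j))" .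
      have "deg (Suc n) \<omega> v = list_degree l v + (\<Sum>j<dM (Suc n) \<omega>. ?b j)"
        using deg_Suc_old_node[of v n \<omega>] v by (simp only: at)
      then have "ennreal (real (deg (Suc n) \<omega> v) + \<delta>)
          = ennreal ((real (list_degree l v) + \<delta>) + real (\<Sum>j<dM (Suc n) \<omega>. ?b j))"
        by (simp only: of_nat_add add.assoc add.commute[of \<delta>])
      also have "\<dots> = ennreal (real (list_degree l v) + \<delta>) + ennreal (real (\<Sum>j<dM (Suc n) \<omega>. ?b j))"
        using \<delta> by (intro ennreal_plus) auto
      finally show ?thesis using E unfolding S_eq by simp
    qed simp
    have "(\<integral>\<^sup>+\<omega>. ennreal (real (deg (Suc n) \<omega> v) + \<delta>) * indicator ?E \<omega> \<partial>M)
        = (\<integral>\<^sup>+\<omega>. ennreal (real (list_degree l v) + \<delta>) * indicator ?E \<omega> + (\<Sum>j. indicator (?S j) \<omega>) \<partial>M)"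
      by (rule nn_integral_cong) (rule pointwise)
    also have "\<dots> = (\<integral>\<^sup>+\<omega>. ennreal (real (list_degree l v) + \<delta>) * indicator ?E \<omega> \<partial>M) + (\<integral>\<^sup>+\<omega>. (\<Sum>j. indicator (?S j) \<omega>) \<partial>M)"
      using S by (intro nn_integral_add) (auto intro!: borel_measurable_suminf)
    also have "(\<integral>\<^sup>+\<omega>. (\<Sum>j. indicator (?S j) \<omega>) \<partial>M) = (\<Sum>j. \<integral>\<^sup>+\<omega>. indicator (?S j) \<omega> \<partial>M)"
      using S by (intro nn_integral_suminf) auto
    also have "(\<Sum>j. \<integral>\<^sup>+\<omega>. indicator (?S j) \<omega> \<partial>M) = (\<Sum>j. ennreal (prob (?S j)))"
      using S by (intro suminf_cong) (simp add: emeasure_eq_measure)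
    also have "\<dots> = (\<Sum>j. ennreal (prob ?E * ?q) * ennreal (prob {\<omega> \<in> space M. j < dM (Suc n) \<omega>}))"
      by (intro suminf_cong) (rule prob_S)
    also have "\<dots> = ennreal (prob ?E * ?q) * ennreal (lam + 1)"
      unfolding ennreal_suminf_cmult by (subst suminf_tail_dM) (use lam in auto)
    also have "(\<integral>\<^sup>+\<omega>. ennreal (real (list_degree l v) + \<delta>) * indicator ?E \<omega> \<partial>M) = ennreal (real (list_degree l v) + \<delta>) * emeasure M ?E"
      by (intro nn_integral_cmult_indicator) measurable
    also have "\<dots> + ennreal (prob ?E * ?q) * ennreal (lam + 1)
        = ennreal ((real (list_degree l v) + \<delta>) * prob ?E + prob ?E * ?q * (lam + 1))"
    proof -
      have a: "0 \<le> real (list_degree l v) + \<delta>" and c: "0 \<le> lam + 1"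
        using \<delta> lam by auto
      have b: "0 \<le> prob ?E * ?q"
        by (rule mult_nonneg_nonneg[OF measure_nonneg q0])
      show ?thesis
        by (simp only: emeasure_eq_measure ennreal_plus[OF mult_nonneg_nonneg[OF a measure_nonneg] mult_nonneg_nonneg[OF b c]]
            ennreal_mult[OF a measure_nonneg] ennreal_mult[OF b c])
    qed
    also have "(real (list_degree l v) + \<delta>) * prob ?E + prob ?E * ?q * (lam + 1)
        = (real (list_degree l v) + \<delta>) * (1 + rate / weight m (length l)) * prob ?E"
      using weight_pos[of m "length l"] by (simp add: rate_def field_simps)
    also have "ennreal \<dots> = ennreal ((real (list_degree l v) + \<delta>) * (1 + rate / weight m (length l))) * emeasure M ?E"
      unfolding emeasure_eq_measure
      by (intro ennreal_mult mult_nonneg_nonneg add_nonneg_nonneg divide_nonneg_nonneg)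
        (use \<delta> rate_pos weight_pos[of m "length l"] in auto)
    finally show ?thesis .
  qed
qed

end

section \<open>The martingale with respect to the history\<close>

context pa_degree_process
begin

abbreviation growth :: "nat \<Rightarrow> 'a \<Rightarrow> real" where
  "growth \<equiv> norm_prod rate \<delta> B dM"

lemma growth_eq: "growth n \<omega> = (\<Prod>k<n. 1 + rate / weight (edges k \<omega>) (node_count B (edges k \<omega>) \<omega>))"
  by (simp add: norm_prod_def nodes_eq weight_def)

lemma growth_ge_1: "1 \<le> growth n \<omega>"
  unfolding growth_eq using rate_pos weight_pos by (intro prod_ge_1) (simp add: less_imp_le)

text \<open>The product for n uses only steps below n. So the normaliser at step K + 1 is already
  determined by the history up to step K, which makes it predictable.\<close>

lemma growth_hist_cong:
  assumes "hist K \<omega> = hist K \<omega>'" "n \<le> Suc K"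
  shows "growth n \<omega> = growth n \<omega>'"
  unfolding growth_eq
proof (intro prod.cong refl)
  fix k assume "k \<in> {..<n}"
  then have "k \<le> K" using assms(2) by auto
  then show "1 + rate / weight (edges k \<omega>) (node_count B (edges k \<omega>) \<omega>) =
      1 + rate / weight (edges k \<omega>') (node_count B (edges k \<omega>') \<omega>')"
    using hist_nth[OF assms(1)] hist_nth[OF refl, of k K \<omega>'] by simp
qed

lemma growth_measurable: "growth n \<in> borel_measurable M"
  unfolding growth_eq[abs_def] weight_def by measurable

lemma nodes_mono: "k \<le> n \<Longrightarrow> nodes B dM k \<omega> \<subseteq> nodes B dM n \<omega>"
  using node_count_mono[OF edge_count_mono[of k n dM \<omega>], of B \<omega>] by (auto simp: nodes_eq)

text \<open>Time is shifted by i, and the indicator asks that v be present at step i. That is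
  decided by the history at every later step, so the indicator acts as a constant factor.\<close>

definition scaled :: "nat \<Rightarrow> nat \<Rightarrow> nat \<Rightarrow> 'a \<Rightarrow> real" where
  "scaled i v n \<omega> = of_bool (v \<in> nodes B dM i \<omega>) * ((real (deg (i + n) \<omega> v) + \<delta>) / growth (i + n) \<omega>)"

lemma scaled_measurable: "scaled i v n \<in> borel_measurable M"
proof -
  note [measurable] = growth_measurable
  have "(\<lambda>\<omega>. of_bool (1 \<le> v \<and> v \<le> node_count B (edges i \<omega>) \<omega>) * ((real (deg (i + n) \<omega> v) + \<delta>) / growth (i + n) \<omega>))
      \<in> borel_measurable M"
    by measurable
  then show ?thesis by (simp add: scaled_def[abs_def] nodes_eq)
qed

lemma scaled_nonneg: "0 \<le> scaled i v n \<omega>"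
  using \<delta> growth_ge_1[of "i + n" \<omega>] by (simp add: scaled_def)

lemma integrable_edges: "integrable M (\<lambda>\<omega>. real (edges n \<omega>))"
  unfolding edge_count_def of_nat_sum
  by (intro Bochner_Integration.integrable_sum integrable_dM) simp

text \<open>The normaliser is at least 1, and one degree is at most the degree sum, hence at most
  the edge count plus 1.\<close>

lemma integrable_scaled: "integrable M (scaled i v n)"
proof (rule Bochner_Integration.integrable_bound)
  show "integrable M (\<lambda>\<omega>. real (edges (i + n) \<omega>) + 1 + \<delta>)"
    using integrable_edges by simp
  show "AE \<omega> in M. norm (scaled i v n \<omega>) \<le> norm (real (edges (i + n) \<omega>) + 1 + \<delta>)"
    using AE_sum_deg
  proof eventually_elim
    case (elim \<omega>)
    let ?N = "node_count B (edges (i + n) \<omega>) \<omega>"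
    have "deg (i + n) \<omega> v \<le> edges (i + n) \<omega> + 1"
    proof (cases "v \<in> {1..?N}")
      case True
      then have "deg (i + n) \<omega> v \<le> (\<Sum>u=1..?N. deg (i + n) \<omega> u)"
        by (intro member_le_sum) auto
      then show ?thesis using elim by simp
    next
      case False then show ?thesis by (subst degree_eq_0) auto
    qed
    then have "real (deg (i + n) \<omega> v) + \<delta> \<le> real (edges (i + n) \<omega>) + 1 + \<delta>" by simp
    moreover have "scaled i v n \<omega> \<le> (real (deg (i + n) \<omega> v) + \<delta>) / 1"
    proof -
      have "(real (deg (i + n) \<omega> v) + \<delta>) / growth (i + n) \<omega> \<le> (real (deg (i + n) \<omega> v) + \<delta>) / 1"
        using growth_ge_1[of "i + n" \<omega>] \<delta> by (intro divide_left_mono) auto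
      then show ?thesis
        using \<delta> by (cases "v \<in> nodes B dM i \<omega>") (simp_all add: scaled_def)
    qed
    ultimately show ?case using scaled_nonneg[of i v n \<omega>] \<delta> by simp
  qed
qed (rule scaled_measurable)

text \<open>With \<open>count_space\<close> as target every function of the history is measurable
  for \<open>info n\<close>.\<close>

definition info :: "nat \<Rightarrow> 'a measure" where
  "info n = vimage_algebra (space M) (hist n) (count_space UNIV)"

lemma space_info [simp]: "space (info n) = space M"
  by (simp add: info_def)

lemma info_sets: "A \<in> sets (info n) \<longleftrightarrow> (\<exists>S. A = hist n -` S \<inter> space M)"
  by (auto simp: info_def sets_vimage_algebra2)

lemma info_subalgebra: "subalgebra M (info n)"
  using measurable_sets[OF hist_measurable] by (auto simp: subalgebra_def info_sets)

lemma info_mono: "subalgebra (info (Suc n)) (info n)"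
proof -
  have "\<exists>S'. hist n -` S \<inter> space M = hist (Suc n) -` S' \<inter> space M" for S
    \<comment> \<open>Dropping the last entry of the longer history recovers the shorter
      one.\<close>
    by (rule exI[of _ "butlast -` S"]) (auto simp: hist_Suc)
  then show ?thesis by (auto simp: subalgebra_def info_sets)
qed

lemma info_measurable: "(\<lambda>\<omega>. f (hist n \<omega>)) \<in> borel_measurable (info n)"
  unfolding info_def by (rule measurable_compose[OF measurable_vimage_algebra1]) auto

lemma scaled_hist:
  assumes "hist (i + n) \<omega> = hist (i + n) \<omega>'"
  shows "scaled i v n \<omega> = scaled i v n \<omega>'"
proof -
  have "edges i \<omega> = edges i \<omega>'" "node_count B (edges i \<omega>) \<omega> = node_count B (edges i \<omega>') \<omega>'" "deg (i + n) \<omega> = deg (i + n) \<omega>'"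
    using hist_nth[OF assms, of i] hist_nth(3)[OF assms, of "i + n"]
      hist_nth[OF refl, of i "i + n" \<omega>'] hist_nth(3)[OF refl, of "i + n" "i + n" \<omega>'] by simp_all
  then show ?thesis
    using growth_hist_cong[OF assms, of "i + n"] by (simp add: scaled_def nodes_eq)
qed

lemma scaled_adapted: "scaled i v n \<in> borel_measurable (info (i + n))"
proof -
  \<comment> \<open>Factors \<open>scaled\<close> through the history by picking an outcome with
    that history; by \<open>scaled_hist\<close> the choice does not matter.\<close>
  define f where "f h = scaled i v n (SOME \<omega>. hist (i + n) \<omega> = h)" for h
  have "scaled i v n \<omega> = f (hist (i + n) \<omega>)" for \<omega>
    unfolding f_def by (rule scaled_hist) (metis (mono_tags) someI)
  then show ?thesis using info_measurable[of f "i + n"] by (simp add: fun_eq_iff cong: measurable_cong)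
qed

lemma scaled_martingale:
  assumes A: "A \<in> sets (info (i + n))"
  shows "(\<integral>\<omega>. indicator A \<omega> * scaled i v (Suc n) \<omega> \<partial>M) = (\<integral>\<omega>. indicator A \<omega> * scaled i v n \<omega> \<partial>M)"
proof -
  let ?n = "i + n"
  note [measurable] = scaled_measurable hist_measurable
  obtain S where S: "A = hist ?n -` S \<inter> space M" using A by (auto simp: info_sets)
  have [measurable]: "A \<in> sets M" using A info_subalgebra[of ?n] by (auto simp: subalgebra_def)
  have step: "(\<integral>\<^sup>+\<omega>. ennreal (indicator A \<omega> * scaled i v (Suc n) \<omega>) * indicator {\<omega> \<in> space M. hist ?n \<omega> = h} \<omega> \<partial>M)
      = (\<integral>\<^sup>+\<omega>. ennreal (indicator A \<omega> * scaled i v n \<omega>) * indicator {\<omega> \<in> space M. hist ?n \<omega> = h} \<omega> \<partial>M)" for h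
  proof (cases "\<exists>\<omega>0\<in>space M. hist ?n \<omega>0 = h \<and> \<omega>0 \<in> A \<and> v \<in> nodes B dM i \<omega>0")
    \<comment> \<open>On such an atom the membership in A, the presence of v, the product for the
      next step and the current degree are constant, with the values they have at \<omega>0. The
      factor gained in \<open>one_step\<close> then cancels the last factor of the product.\<close>
    case True
    then obtain \<omega>0 where \<omega>0: "\<omega>0 \<in> space M" "hist ?n \<omega>0 = h" "\<omega>0 \<in> A" "v \<in> nodes B dM i \<omega>0" by auto
    let ?E = "{\<omega> \<in> space M. hist ?n \<omega> = h}"
    let ?m = "fst (last h)" and ?l = "snd (last h)"
    have "h ! ?n = last h"
      using length_hist[of ?n \<omega>0] \<omega>0(2) by (metis last_conv_nth diff_Suc_1 list.size(3) nat.distinct(1))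
    then have at: "edges ?n \<omega>0 = ?m" "node_count B (edges ?n \<omega>0) \<omega>0 = length ?l" "deg ?n \<omega>0 = list_degree ?l"
      using hist_nth[OF \<omega>0(2) order_refl] by simp_all
    have v: "v \<in> {1..length ?l}"
      using \<omega>0(4) nodes_mono[of i ?n \<omega>0] at by (auto simp: nodes_eq)
    let ?g = "growth ?n \<omega>0" and ?r = "1 + rate / weight ?m (length ?l)"
    have r: "0 < ?r" using rate_pos weight_pos[of ?m "length ?l"] by (simp add: add_pos_pos)
    have g: "0 < ?g" using growth_ge_1[of ?n \<omega>0] by simp
    have g': "growth (Suc ?n) \<omega>0 = ?g * ?r"
      unfolding growth_eq lessThan_Suc using at by (simp only: prod.insert finite_lessThan lessThan_iff less_irrefl not_False_eq_True mult.commute)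
    have same: "\<omega> \<in> A" "v \<in> nodes B dM i \<omega>" "growth (Suc ?n) \<omega> = ?g * ?r" "growth ?n \<omega> = ?g" "deg ?n \<omega> v = list_degree ?l v"
      if "\<omega> \<in> ?E" for \<omega>
    proof -
      have eq: "hist ?n \<omega> = hist ?n \<omega>0" using that \<omega>0(2) by simp
      show "\<omega> \<in> A" using that \<omega>0 by (auto simp: S)
      show "v \<in> nodes B dM i \<omega>"
        using \<omega>0(4) hist_nth(2)[OF eq, of i] hist_nth(2)[OF refl, of i ?n \<omega>0] by (simp add: nodes_eq)
      show "growth (Suc ?n) \<omega> = ?g * ?r" "growth ?n \<omega> = ?g"
        using growth_hist_cong[OF eq, of "Suc ?n"] growth_hist_cong[OF eq, of ?n] g' by simp_all
      show "deg ?n \<omega> v = list_degree ?l v"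
        using hist_nth(3)[OF eq, of ?n] hist_nth(3)[OF refl, of ?n ?n \<omega>0] at(3) by simp
    qed
    have "(\<integral>\<^sup>+\<omega>. ennreal (indicator A \<omega> * scaled i v (Suc n) \<omega>) * indicator ?E \<omega> \<partial>M)
        = (\<integral>\<^sup>+\<omega>. ennreal (1 / (?g * ?r)) * (ennreal (real (deg (Suc ?n) \<omega> v) + \<delta>) * indicator ?E \<omega>) \<partial>M)"
    proof (rule nn_integral_cong)
      fix \<omega> assume "\<omega> \<in> space M"
      show "ennreal (indicator A \<omega> * scaled i v (Suc n) \<omega>) * indicator ?E \<omega> =
          ennreal (1 / (?g * ?r)) * (ennreal (real (deg (Suc ?n) \<omega> v) + \<delta>) * indicator ?E \<omega>)"
      proof (cases "\<omega> \<in> ?E")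
        case True
        have "indicator A \<omega> * scaled i v (Suc n) \<omega> = 1 / (?g * ?r) * (real (deg (Suc ?n) \<omega> v) + \<delta>)"
          using same(1-3)[OF True] by (simp add: scaled_def del: pa_degree.simps)
        moreover have "0 \<le> 1 / (?g * ?r)" "0 \<le> real (deg (Suc ?n) \<omega> v) + \<delta>"
          using r g \<delta> by (simp_all del: pa_degree.simps)
        ultimately show ?thesis using True by (simp only: ennreal_mult indicator_simps mult_1_right)
      qed simp
    qed
    also have "\<dots> = ennreal (1 / (?g * ?r)) * (\<integral>\<^sup>+\<omega>. ennreal (real (deg (Suc ?n) \<omega> v) + \<delta>) * indicator ?E \<omega> \<partial>M)"
      by (rule nn_integral_cmult) measurable
    also have "\<dots> = ennreal (1 / (?g * ?r)) * (ennreal ((real (list_degree ?l v) + \<delta>) * ?r) * emeasure M ?E)"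
      by (simp only: one_step[OF v])
    also have "\<dots> = ennreal ((real (list_degree ?l v) + \<delta>) / ?g) * emeasure M ?E"
    proof -
      have "ennreal (1 / (?g * ?r)) * ennreal ((real (list_degree ?l v) + \<delta>) * ?r) = ennreal (1 / (?g * ?r) * ((real (list_degree ?l v) + \<delta>) * ?r))"
        by (rule ennreal_mult[symmetric]) (use r g \<delta> in simp_all)
      also have "1 / (?g * ?r) * ((real (list_degree ?l v) + \<delta>) * ?r) = (real (list_degree ?l v) + \<delta>) / ?g"
        using r g by (simp only: times_divide_eq_left mult_1_left) (subst mult_divide_mult_cancel_right, auto)
      finally show ?thesis by (simp only: mult.assoc[symmetric])
    qed
    also have "\<dots> = (\<integral>\<^sup>+\<omega>. ennreal ((real (list_degree ?l v) + \<delta>) / ?g) * indicator ?E \<omega> \<partial>M)"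
      by (intro nn_integral_cmult_indicator[symmetric]) measurable
    also have "\<dots> = (\<integral>\<^sup>+\<omega>. ennreal (indicator A \<omega> * scaled i v n \<omega>) * indicator ?E \<omega> \<partial>M)"
    proof (rule nn_integral_cong)
      fix \<omega> assume "\<omega> \<in> space M"
      show "ennreal ((real (list_degree ?l v) + \<delta>) / ?g) * indicator ?E \<omega> = ennreal (indicator A \<omega> * scaled i v n \<omega>) * indicator ?E \<omega>"
      proof (cases "\<omega> \<in> ?E")
        case True
        then show ?thesis using same(1,2,4,5)[OF True] by (simp add: scaled_def)
      qed simp
    qed
    finally show ?thesis .
  next
    \<comment> \<open>No outcome of the atom lies in A with v present, so both integrands vanish on
      it.\<close>
    case False
    have Z: "indicator A \<omega> * scaled i v m \<omega> = 0" if "\<omega> \<in> space M" "hist ?n \<omega> = h" for \<omega> m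
      using that False by (auto simp: scaled_def)
    have z: "ennreal (indicator A \<omega> * scaled i v m \<omega>) * indicator {\<omega> \<in> space M. hist ?n \<omega> = h} \<omega> = 0"
      if "\<omega> \<in> space M" for \<omega> m
    proof (cases "hist ?n \<omega> = h")
      case True then show ?thesis by (simp only: Z[OF that True] ennreal_0 mult_zero_left)
    qed simp
    show ?thesis by (rule nn_integral_cong) (simp only: z)
  qed
  have "(\<integral>\<^sup>+\<omega>. ennreal (indicator A \<omega> * scaled i v (Suc n) \<omega>) \<partial>M) = (\<integral>\<^sup>+\<omega>. ennreal (indicator A \<omega> * scaled i v n \<omega>) \<partial>M)"
    by (rule nn_integral_eq_on_partition[OF hist_measurable _ _ step]) measurable
  moreover have "(\<integral>\<omega>. indicator A \<omega> * scaled i v m \<omega> \<partial>M) = enn2real (\<integral>\<^sup>+\<omega>. ennreal (indicator A \<omega> * scaled i v m \<omega>) \<partial>M)" for m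
    by (intro integral_eq_nn_integral) (auto intro!: AE_I2 mult_nonneg_nonneg scaled_nonneg)
  ultimately show ?thesis by simp
qed

lemma AE_scaled_convergent: "AE \<omega> in M. convergent (\<lambda>n. scaled i v n \<omega>)"
proof (rule nonneg_supermartingale_convergent)
  show "subalgebra M (info (i + n))" "subalgebra (info (i + Suc n)) (info (i + n))"
    "scaled i v n \<in> borel_measurable (info (i + n))" "integrable M (scaled i v n)" for n
    using info_subalgebra info_mono[of "i + n"] scaled_adapted integrable_scaled by auto
qed (auto simp: scaled_nonneg scaled_martingale)

end

section \<open>Growth of the normalising product\<close>

lemma summable_inverse_Suc_square: "summable (\<lambda>k. inverse ((real (Suc k))\<^sup>2))"
  using inverse_power_summable[of 2, where 'a = real] summable_Suc_iff[of "\<lambda>k. inverse ((real k)\<^sup>2)"]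
  by (simp del: of_nat_Suc)

text \<open>Taking logarithms leaves two summable corrections: from ln (1 + c/w) to c/w, and from
  c/w to c / (\<kappa> (k + 1)). What remains is c/\<kappa> times a harmonic number, so the limit is
  an exponential involving the Euler-Mascheroni constant, hence positive.\<close>

lemma prod_asymp_powr:
  fixes w :: "nat \<Rightarrow> real"
  assumes c: "0 < c" and \<kappa>: "0 < \<kappa>"
    and w: "\<And>k. real (Suc k) \<le> w k"
    and sum: "summable (\<lambda>k. \<bar>w k - \<kappa> * real (Suc k)\<bar> / (real (Suc k))\<^sup>2)"
  shows "\<exists>L>0. (\<lambda>n. (\<Prod>k<n. 1 + c / w k) / real n powr (c / \<kappa>)) \<longlonglongrightarrow> L"
proof -
  have w0: "0 < w k" for k using w[of k] by linarith
  have 1: "summable (\<lambda>k. ln (1 + c / w k) - c / w k)"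
  proof (rule summable_comparison_test_ev)
    show "summable (\<lambda>k. c\<^sup>2 / (real (Suc k))\<^sup>2)"
      unfolding divide_inverse by (rule summable_mult[OF summable_inverse_Suc_square])
    show "\<forall>\<^sub>F k in sequentially. norm (ln (1 + c / w k) - c / w k) \<le> c\<^sup>2 / (real (Suc k))\<^sup>2"
    proof (rule eventually_sequentiallyI)
      \<comment> \<open>From here on c / w k is at most 1, where the quadratic bound for the
        logarithm is available.\<close>
      fix k assume k: "nat \<lceil>c\<rceil> \<le> k"
      then have "c \<le> w k" using w[of k] by (simp add: nat_le_iff ceiling_le_iff)
      then have "\<bar>ln (1 + c / w k) - c / w k\<bar> \<le> (c / w k)\<^sup>2"
        using w0[of k] c by (intro abs_ln_one_plus_x_minus_x_bound_nonneg) auto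
      also have "\<dots> \<le> (c / real (Suc k))\<^sup>2"
        using w[of k] w0[of k] c by (intro power_mono divide_left_mono) auto
      finally show "norm (ln (1 + c / w k) - c / w k) \<le> c\<^sup>2 / (real (Suc k))\<^sup>2"
        by (simp add: power_divide)
    qed
  qed
  have 2: "summable (\<lambda>k. c / w k - c / (\<kappa> * real (Suc k)))"
  proof (rule summable_comparison_test')
    show "summable (\<lambda>k. c / \<kappa> * (\<bar>w k - \<kappa> * real (Suc k)\<bar> / (real (Suc k))\<^sup>2))"
      by (rule summable_mult) (rule sum)
    fix k :: nat
    \<comment> \<open>The exact difference has w k in the denominator; the lower bound on w replaces
      it by k + 1, which gives the hypothesis \<open>sum\<close>.\<close>
    have "norm (c / w k - c / (\<kappa> * real (Suc k))) = c / \<kappa> * (\<bar>w k - \<kappa> * real (Suc k)\<bar> / (real (Suc k) * w k))"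
    proof -
      have "c / w k - c / (\<kappa> * real (Suc k)) = - (c / \<kappa> * ((w k - \<kappa> * real (Suc k)) / (real (Suc k) * w k)))"
        using w0[of k] \<kappa> by (simp add: field_simps del: of_nat_Suc)
      then show ?thesis using c \<kappa> w0[of k] by (simp add: abs_mult del: of_nat_Suc)
    qed
    also have "\<dots> \<le> c / \<kappa> * (\<bar>w k - \<kappa> * real (Suc k)\<bar> / (real (Suc k))\<^sup>2)"
      unfolding power2_eq_square using c \<kappa> w[of k] w0[of k]
      by (intro mult_left_mono divide_left_mono) auto
    finally show "norm (c / w k - c / (\<kappa> * real (Suc k))) \<le> c / \<kappa> * (\<bar>w k - \<kappa> * real (Suc k)\<bar> / (real (Suc k))\<^sup>2)" .
  qed
  have "summable (\<lambda>k. ln (1 + c / w k) - c / (\<kappa> * real (Suc k)))"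
    using summable_add[OF 1 2] by (simp only: add_diff_eq diff_add_cancel)
  then obtain A where A: "(\<lambda>n. \<Sum>k<n. ln (1 + c / w k) - c / (\<kappa> * real (Suc k))) \<longlonglongrightarrow> A"
    by (auto simp: summable_def sums_def)
  have "(\<lambda>n. exp ((\<Sum>k<n. ln (1 + c / w k) - c / (\<kappa> * real (Suc k))) + c / \<kappa> * (harm n - ln (real n))))
      \<longlonglongrightarrow> exp (A + c / \<kappa> * euler_mascheroni)"
    by (intro tendsto_intros A euler_mascheroni_LIMSEQ)
  moreover have "\<forall>\<^sub>F n in sequentially.
      exp ((\<Sum>k<n. ln (1 + c / w k) - c / (\<kappa> * real (Suc k))) + c / \<kappa> * (harm n - ln (real n)))
      = (\<Prod>k<n. 1 + c / w k) / real n powr (c / \<kappa>)"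
  proof (rule eventually_sequentiallyI)
    fix n :: nat assume n: "1 \<le> n"
    have harm: "c / \<kappa> * harm n = (\<Sum>k<n. c / (\<kappa> * real (Suc k)))"
    proof -
      have "harm n = (\<Sum>k<n. inverse (real (Suc k)))"
        unfolding harm_def by (simp add: sum.atLeast1_atMost_eq)
      then show ?thesis by (simp add: sum_distrib_left divide_inverse mult.assoc)
    qed
    have "(\<Sum>k<n. ln (1 + c / w k) - c / (\<kappa> * real (Suc k))) + c / \<kappa> * (harm n - ln (real n))
        = (\<Sum>k<n. ln (1 + c / w k)) - c / \<kappa> * ln (real n)"
      unfolding right_diff_distrib harm sum_subtractf by simp
    moreover have "exp (\<Sum>k<n. ln (1 + c / w k)) = (\<Prod>k<n. 1 + c / w k)"
    proof -
      have "0 < 1 + c / w k" for k using c w0[of k] by (simp add: add_pos_pos)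
      then show ?thesis by (simp add: exp_sum)
    qed
    moreover have "exp (c / \<kappa> * ln (real n)) = real n powr (c / \<kappa>)"
      using n by (simp add: powr_def)
    ultimately show "exp ((\<Sum>k<n. ln (1 + c / w k) - c / (\<kappa> * real (Suc k))) + c / \<kappa> * (harm n - ln (real n)))
      = (\<Prod>k<n. 1 + c / w k) / real n powr (c / \<kappa>)"
      by (simp add: exp_diff)
  qed
  ultimately have "(\<lambda>n. (\<Prod>k<n. 1 + c / w k) / real n powr (c / \<kappa>)) \<longlonglongrightarrow> exp (A + c / \<kappa> * euler_mascheroni)"
    by (rule Lim_transform_eventually)
  then show ?thesis by (intro exI[of _ "exp (A + c / \<kappa> * euler_mascheroni)"]) simp
qed

text \<open>By monotone convergence the sum has a finite integral, so it is finite almost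
  everywhere.\<close>

lemma AE_summable_of_integral:
  fixes f :: "nat \<Rightarrow> 'a \<Rightarrow> real"
  assumes int: "\<And>n. integrable M (f n)" and nonneg: "\<And>n \<omega>. 0 \<le> f n \<omega>"
    and bound: "\<And>n. (\<integral>\<omega>. f n \<omega> \<partial>M) \<le> b n" and b: "summable b"
  shows "AE \<omega> in M. summable (\<lambda>n. f n \<omega>)"
proof -
  have [measurable]: "f n \<in> borel_measurable M" for n using int by auto
  have sum: "summable (\<lambda>n. \<integral>\<omega>. f n \<omega> \<partial>M)"
    using nonneg bound b by (intro summable_comparison_test'[OF b, of 0]) (simp add: Bochner_Integration.integral_nonneg nonneg)
  have "(\<integral>\<^sup>+\<omega>. (\<Sum>n. ennreal (f n \<omega>)) \<partial>M) = (\<Sum>n. \<integral>\<^sup>+\<omega>. ennreal (f n \<omega>) \<partial>M)"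
    by (rule nn_integral_suminf) simp
  also have "\<dots> = (\<Sum>n. ennreal (\<integral>\<omega>. f n \<omega> \<partial>M))"
    by (intro suminf_cong nn_integral_eq_integral int) (simp add: nonneg)
  also have "\<dots> = ennreal (\<Sum>n. \<integral>\<omega>. f n \<omega> \<partial>M)"
    using sum by (intro suminf_ennreal2) (auto intro!: Bochner_Integration.integral_nonneg nonneg)
  finally have "(\<integral>\<^sup>+\<omega>. (\<Sum>n. ennreal (f n \<omega>)) \<partial>M) \<noteq> \<infinity>" by simp
  then have "AE \<omega> in M. (\<Sum>n. ennreal (f n \<omega>)) \<noteq> \<infinity>"
    by (intro nn_integral_noteq_infinite) auto
  then show ?thesis
    by eventually_elim (auto intro!: summable_suminf_not_top nonneg)
qed

text \<open>Meant for x the random edge count and s the step number: it makes the coin error at a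
  random index linear in the edge count, whose deviations are controlled.\<close>

lemma powr_three_quarters_le:
  fixes x s :: real
  assumes "0 \<le> x" "0 < s"
  shows "x powr (3/4) \<le> s powr (3/4) + x * s powr (-1/4)"
proof (cases "x \<le> s")
  case True
  then have "x powr (3/4) \<le> s powr (3/4)" using assms by (intro powr_mono2) auto
  moreover have "0 \<le> x * s powr (-1/4)" using assms by simp
  ultimately show ?thesis by linarith
next
  case False
  have "x powr (3/4) = x powr (1 + (-1/4))" by simp
  also have "\<dots> = x * x powr (-1/4)"
    using False assms by (subst powr_add) simp
  also have "\<dots> \<le> x * s powr (-1/4)"
    using False assms by (intro mult_left_mono powr_mono2') auto
  finally show ?thesis using powr_ge_zero[of s "3/4"] by linarith
qed

section \<open>Almost sure deviations of edge counts and coin sums\<close>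

context pa_driving
begin

text \<open>Cross terms vanish by independence, and the variance of one batch is that of a Poisson
  variable, namely \<open>lam\<close>.\<close>

lemma integrable_edges_deviation_square:
    "integrable M (\<lambda>\<omega>. (real (edge_count dM n \<omega>) - (lam + 1) * real n)\<^sup>2)"
  and expectation_edges_deviation_square:
    "expectation (\<lambda>\<omega>. (real (edge_count dM n \<omega>) - (lam + 1) * real n)\<^sup>2) = lam * real n"
proof -
  define Y where "Y k \<omega> = real (dM k \<omega>) - (lam + 1)" for k \<omega>
  have Y_int: "integrable M (Y k)" "expectation (Y k) = 0" if "k \<ge> 1" for k
    unfolding Y_def[abs_def] using that by (simp_all add: integrable_dM expectation_dM prob_space)
  have Y2: "integrable M (\<lambda>\<omega>. (Y k \<omega>)\<^sup>2)" "expectation (\<lambda>\<omega>. (Y k \<omega>)\<^sup>2) = lam" if k: "k \<ge> 1" for k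
  proof -
    have eq: "(\<lambda>\<omega>. (Y k \<omega>)\<^sup>2) = (\<lambda>\<omega>. (real (dM k \<omega>))\<^sup>2 - 2 * (lam + 1) * real (dM k \<omega>) + (lam + 1)\<^sup>2)"
      by (simp add: Y_def power2_diff fun_eq_iff algebra_simps)
    show "integrable M (\<lambda>\<omega>. (Y k \<omega>)\<^sup>2)" "expectation (\<lambda>\<omega>. (Y k \<omega>)\<^sup>2) = lam"
      unfolding eq using integrable_dM[OF k] integrable_dM_square[OF k]
      by (simp_all add: expectation_dM[OF k] expectation_dM_square[OF k] prob_space)
        (simp add: power2_eq_square algebra_simps)
  qed
  have "indep_vars (\<lambda>_. borel) (\<lambda>k. src (Batch k)) {1..}"
    by (rule indep_vars_reindex[OF indep_src]) (auto simp: sources_def intro!: inj_onI)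
  from indep_vars_compose2[OF this, of "\<lambda>_ x. x - (lam + 1)" "\<lambda>_. borel"]
  have ind: "indep_vars (\<lambda>_. borel) Y {1..}"
    by (simp add: Y_def[abs_def] src_def)
  have sum_eq: "real (edge_count dM n \<omega>) - (lam + 1) * real n = (\<Sum>k=1..n. Y k \<omega>)" for n \<omega>
    by (simp add: edge_count_def Y_def sum_subtractf)
  have "integrable M (\<lambda>\<omega>. (\<Sum>k=1..n. Y k \<omega>)\<^sup>2) \<and> expectation (\<lambda>\<omega>. (\<Sum>k=1..n. Y k \<omega>)\<^sup>2) = lam * real n"
  proof (induction n)
    case (Suc n)
    let ?S = "\<lambda>\<omega>. \<Sum>k=1..n. Y k \<omega>"
    have indep: "indep_var borel (Y (Suc n)) borel ?S"
      by (rule indep_vars_sum) (auto intro!: indep_vars_subset[OF ind])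
    have S: "integrable M ?S" using Y_int by (intro Bochner_Integration.integrable_sum) auto
    have YS: "integrable M (\<lambda>\<omega>. Y (Suc n) \<omega> * ?S \<omega>)" "expectation (\<lambda>\<omega>. Y (Suc n) \<omega> * ?S \<omega>) = 0"
      using indep_var_integrable[OF indep] indep_var_lebesgue_integral[OF indep] Y_int[of "Suc n"] S by auto
    have eq: "(\<lambda>\<omega>. (\<Sum>k=1..Suc n. Y k \<omega>)\<^sup>2) = (\<lambda>\<omega>. (?S \<omega>)\<^sup>2 + 2 * (Y (Suc n) \<omega> * ?S \<omega>) + (Y (Suc n) \<omega>)\<^sup>2)"
      by (simp add: fun_eq_iff power2_sum algebra_simps)
    show ?case
      unfolding eq using Suc YS Y2[of "Suc n"] by (auto simp: algebra_simps)
  qed simp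
  then show "integrable M (\<lambda>\<omega>. (real (edge_count dM n \<omega>) - (lam + 1) * real n)\<^sup>2)"
    "expectation (\<lambda>\<omega>. (real (edge_count dM n \<omega>) - (lam + 1) * real n)\<^sup>2) = lam * real n"
    by (simp_all add: sum_eq)
qed

text \<open>The squared deviation at k has mean \<open>lam\<close> k, so weighted by (k + 1) to the
  power -5/2 it is summable almost surely. The arithmetic-geometric mean inequality then passes from
  squares to absolute values at the cost of a summable power -3/2.\<close>

lemma AE_summable_edges_deviation:
  assumes lam: "0 < lam"
  shows "AE \<omega> in M. summable (\<lambda>k. \<bar>real (edge_count dM k \<omega>) - (lam + 1) * real k\<bar> / (real (Suc k))\<^sup>2)"
proof -
  let ?X = "\<lambda>k \<omega>. real (edge_count dM k \<omega>) - (lam + 1) * real k"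
  have sum32: "summable (\<lambda>k. real (Suc k) powr (-3/2))"
    using summable_real_powr_iff[of "-3/2"] by (simp only: summable_Suc_iff[of "\<lambda>k. real k powr (-3/2)"])
  have "AE \<omega> in M. summable (\<lambda>k. (?X k \<omega>)\<^sup>2 * real (Suc k) powr (-5/2))"
  proof (rule AE_summable_of_integral)
    fix k
    have "expectation (\<lambda>\<omega>. (?X k \<omega>)\<^sup>2 * real (Suc k) powr (-5/2)) = lam * real k * real (Suc k) powr (-5/2)"
      by (simp add: expectation_edges_deviation_square)
    also have "\<dots> \<le> lam * real (Suc k) * real (Suc k) powr (-5/2)"
      using lam by (intro mult_right_mono) auto
    also have "\<dots> = lam * (real (Suc k) powr (1 + (-5/2)))"
      by (subst powr_add) simp
    finally show "expectation (\<lambda>\<omega>. (?X k \<omega>)\<^sup>2 * real (Suc k) powr (-5/2)) \<le> lam * (real (Suc k) powr (-3/2))"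
      by simp
  qed (use sum32 integrable_edges_deviation_square in \<open>auto intro!: summable_mult\<close>)
  then show ?thesis
  proof eventually_elim
    case (elim \<omega>)
    show ?case
    proof (rule summable_comparison_test'[OF summable_add[OF elim sum32]])
      fix k :: nat
      let ?s = "real (Suc k)" and ?x = "\<bar>?X k \<omega>\<bar>"
      \<comment> \<open>The exponents 1/4 are balanced so that, after division by the square of k +
        1, both resulting terms are summable.\<close>
      have "0 \<le> (?x * ?s powr (-1/4) - ?s powr (1/4))\<^sup>2" by simp
      also have "\<dots> = ?x\<^sup>2 * ?s powr (-1/2) + ?s powr (1/2) - 2 * ?x"
      proof -
        have "?s powr (-1/4) * ?s powr (1/4) = 1" "(?s powr (-1/4))\<^sup>2 = ?s powr (-1/2)" "(?s powr (1/4))\<^sup>2 = ?s powr (1/2)"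
          by (simp_all add: power2_eq_square powr_add[symmetric])
        then show ?thesis by (simp add: power2_diff power_mult_distrib mult.assoc)
      qed
      finally have "2 * ?x \<le> ?x\<^sup>2 * ?s powr (-1/2) + ?s powr (1/2)"
        by (simp only: diff_ge_0_iff_ge)
      moreover have "?x \<le> 2 * ?x" by simp
      ultimately have "?x \<le> ?x\<^sup>2 * ?s powr (-1/2) + ?s powr (1/2)"
        by (rule order_trans[rotated])
      then have "?x * ?s powr (-2) \<le> (?x\<^sup>2 * ?s powr (-1/2) + ?s powr (1/2)) * ?s powr (-2)"
        by (intro mult_right_mono) auto
      also have "\<dots> = (?X k \<omega>)\<^sup>2 * ?s powr (-5/2) + ?s powr (-3/2)"
        by (simp add: ring_distribs mult.assoc powr_add[symmetric])
      finally have "?x * ?s powr (-2) \<le> (?X k \<omega>)\<^sup>2 * ?s powr (-5/2) + ?s powr (-3/2)" .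
      moreover have "?s powr (-2) = inverse (?s\<^sup>2)" by (simp add: powr_minus)
      ultimately show "norm (?x / ?s\<^sup>2) \<le> (?X k \<omega>)\<^sup>2 * ?s powr (-5/2) + ?s powr (-3/2)"
        by (simp only: real_norm_def divide_inverse abs_mult abs_inverse abs_idempotent abs_power2)
    qed
  qed
qed

lemma expectation_B:
  assumes k: "k \<ge> 1"
  shows "expectation (\<lambda>\<omega>. real (B k \<omega>)) = p"
proof -
  have [measurable]: "B k \<in> measurable M (count_space UNIV)" using B_rv[OF k] .
  have "expectation (\<lambda>\<omega>. real (B k \<omega>)) = expectation (indicator {\<omega> \<in> space M. B k \<omega> = 1})"
  proof (rule integral_cong_AE)
    show "AE \<omega> in M. real (B k \<omega>) = indicator {\<omega> \<in> space M. B k \<omega> = 1} \<omega>"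
      using AE_B_le_1
    proof (rule AE_mp, intro AE_I2 impI)
      fix \<omega> assume "\<omega> \<in> space M" "\<forall>k\<ge>1. B k \<omega> \<le> 1"
      then show "real (B k \<omega>) = indicator {\<omega> \<in> space M. B k \<omega> = 1} \<omega>"
        using k by (cases "B k \<omega>") (auto simp: le_Suc_eq)
    qed
  qed auto
  then show ?thesis using B_one[OF k] by simp
qed

text \<open>Hoeffding at the threshold m to the power 3/4 gives 2 exp (- 2 sqrt m), which
  Borel-Cantelli can use; Chebyshev would give only the order m to the power -1/2. The bound is
  needed for all large m because m will be a random edge count.\<close>

lemma AE_coins_deviation:
  "AE \<omega> in M. eventually (\<lambda>m. \<bar>(\<Sum>k=1..m. real (B k \<omega>)) - p * real m\<bar> \<le> real m powr (3/4)) sequentially"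
proof -
  let ?S = "\<lambda>m \<omega>. (\<Sum>k=1..m. real (B k \<omega>)) - p * real m"
  define C where "C m = {\<omega> \<in> space M. real m powr (3/4) \<le> \<bar>?S m \<omega>\<bar>}" for m
  have C[measurable]: "C m \<in> sets M" for m
  proof -
    have [measurable]: "B k \<in> measurable M (count_space UNIV)" if "k \<in> {1..m}" for k
      using B_rv that by auto
    show ?thesis unfolding C_def by measurable
  qed
  have le: "prob (C m) \<le> 32 * inverse ((real m)\<^sup>2)" if m: "m \<ge> 1" for m
  proof -
    have "indep_vars (\<lambda>_. borel) (\<lambda>k. src (Coin k)) {1..m}"
      by (rule indep_vars_reindex[OF indep_src]) (auto simp: sources_def intro!: inj_onI)
    then have ind: "indep_vars (\<lambda>_. borel) (\<lambda>k \<omega>. real (B k \<omega>)) {1..m}"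
      by (simp add: src_def[abs_def])
    interpret H: Hoeffding_ineq M "{1..m}" "\<lambda>k \<omega>. real (B k \<omega>)" "\<lambda>_. 0" "\<lambda>_. 1" "p * real m"
    proof unfold_locales
      show "AE \<omega> in M. real (B k \<omega>) \<in> {0..1}" if "k \<in> {1..m}" for k
        using AE_B_le_1 by eventually_elim (use that in auto)
      show "p * real m \<equiv> \<Sum>k\<in>{1..m}. expectation (\<lambda>\<omega>. real (B k \<omega>))"
        by (rule eq_reflection) (simp add: expectation_B)
    qed (use ind in auto)
    have "prob (C m) \<le> 2 * exp (- 2 * (real m powr (3/4))\<^sup>2 / real m)"
      using H.Hoeffding_ineq_abs_ge[of "real m powr (3/4)"] m by (simp add: C_def)
    also have "(real m powr (3/4))\<^sup>2 = real m * sqrt (real m)"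
    proof -
      have "(real m powr (3/4))\<^sup>2 = real m powr (1 + 1/2)"
        by (simp add: power2_eq_square powr_add[symmetric])
      then show ?thesis using m by (simp only: powr_add) (simp add: powr_half_sqrt)
    qed
    also have "- 2 * (real m * sqrt (real m)) / real m = - (2 * sqrt (real m))"
      using m by simp
    also have "2 * exp (- (2 * sqrt (real m))) \<le> 2 * (16 * inverse ((real m)\<^sup>2))"
    proof -
      \<comment> \<open>The shift by 4 makes the base exactly sqrt m / 2, so its fourth power is of
        order m squared; this is where 16, and with the factor 2 the 32 above, come from.\<close>
      have "(real m)\<^sup>2 / 16 = (1 + (2 * sqrt (real m) - 4) / real 4) ^ 4"
      proof -
        have "(1 + (2 * sqrt (real m) - 4) / real 4) ^ 4 = (sqrt (real m)) ^ (2 * 2) / 16"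
          by (simp add: power_divide field_simps)
        then show ?thesis by (simp only: power_mult) simp
      qed
      also have "\<dots> \<le> exp (2 * sqrt (real m) - 4)"
        by (intro exp_ge_one_plus_x_over_n_power_n) auto
      also have "\<dots> \<le> exp (2 * sqrt (real m))" by simp
      finally show ?thesis using m by (simp add: exp_minus field_simps)
    qed
    finally show ?thesis by simp
  qed
  have "summable (\<lambda>m. prob (C m))"
  proof (rule summable_comparison_test')
    show "summable (\<lambda>m. 32 * inverse ((real m)\<^sup>2))"
      using inverse_power_summable[of 2, where 'a = real] by (intro summable_mult) simp
    show "norm (prob (C m)) \<le> 32 * inverse ((real m)\<^sup>2)" if "m \<ge> 1" for m
      using le[OF that] by simp
  qed
  then have "AE \<omega> in M. eventually (\<lambda>m. \<omega> \<in> space M - C m) sequentially"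
    by (intro borel_cantelli_AE1) (auto simp: emeasure_eq_measure)
  then show ?thesis
    by eventually_elim (auto simp: C_def elim!: eventually_mono)
qed

end

section \<open>The order of the product and the limits of the degrees\<close>

context pa_degree_process
begin

text \<open>This is \<open>rate\<close> divided by \<kappa>, with the common factor \<lambda> + 1
  cancelled.\<close>

definition growth_exponent :: real where
  "growth_exponent = (1 - real \<theta> * p) / (1 + \<delta> * p)"

lemma growth_exponent_pos: "0 < growth_exponent"
  using rate_pos lam \<delta> p by (simp add: growth_exponent_def rate_def zero_less_mult_iff add_pos_pos)

lemma AE_growth_asymp: "AE \<omega> in M. \<exists>L>0. (\<lambda>n. growth n \<omega> / real n powr growth_exponent) \<longlonglongrightarrow> L"
  using AE_dM_ge_1 AE_coins_deviation AE_summable_edges_deviation[OF lam]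
proof eventually_elim
  case (elim \<omega>)
  define \<kappa> where "\<kappa> = (lam + 1) * (1 + \<delta> * p)"
  define X where "X k = real (edges k \<omega>) - (lam + 1) * real k" for k
  define w where "w k = weight (edges k \<omega>) (node_count B (edges k \<omega>) \<omega>)" for k
  \<comment> \<open>What is left of the initial edge unit and the initial node when w at k is
    compared with \<kappa> (k + 1) rather than \<kappa> k.\<close>
  define C where "C = \<bar>1 + \<delta> - \<kappa>\<bar>"
  have \<kappa>: "0 < \<kappa>" using lam \<delta> p by (simp add: \<kappa>_def add_pos_pos)
  have k_le: "k \<le> edges k \<omega>" for k
  proof -
    have "(\<Sum>j=1..k. 1) \<le> (\<Sum>j=1..k. dM j \<omega>)" using elim(1) by (intro sum_mono) auto
    then show ?thesis by (simp add: edge_count_def)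
  qed
  have w: "real (Suc k) \<le> w k" for k
  proof -
    have "0 \<le> \<delta> * real (node_count B (edges k \<omega>) \<omega>)" using \<delta> by simp
    then show ?thesis using k_le[of k] by (simp add: w_def weight_def)
  qed
  obtain m0 where m0: "\<And>m. m \<ge> m0 \<Longrightarrow> \<bar>(\<Sum>k=1..m. real (B k \<omega>)) - p * real m\<bar> \<le> real m powr (3/4)"
    using elim(2) by (auto simp: eventually_sequentially)
  have "summable (\<lambda>k. \<bar>w k - \<kappa> * real (Suc k)\<bar> / (real (Suc k))\<^sup>2)"
  proof (rule summable_comparison_test')
    have s1: "summable (\<lambda>k. \<bar>X k\<bar> / (real (Suc k))\<^sup>2)"
      using elim(3) by (simp only: X_def)
    have s2: "summable (\<lambda>k. real (Suc k) powr (-5/4))"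
      using summable_real_powr_iff[of "-5/4"] by (simp only: summable_Suc_iff[of "\<lambda>k. real k powr (-5/4)"])
    show "summable (\<lambda>k. (1 + \<delta> * p + \<delta>) * (\<bar>X k\<bar> / (real (Suc k))\<^sup>2) + \<delta> * (lam + 2) * real (Suc k) powr (-5/4)
        + C * inverse ((real (Suc k))\<^sup>2))"
      by (intro summable_add summable_mult s1 s2 summable_inverse_Suc_square)
    fix k assume k: "k \<ge> m0"
    let ?s = "real (Suc k)" and ?m = "edges k \<omega>"
    let ?D = "(\<Sum>j=1..?m. real (B j \<omega>)) - p * real ?m"
    \<comment> \<open>Each batch has at least one edge, so the edge count is at least k \<ge> m0 and
      the coin bound holds at this random index.\<close>
    have "\<bar>?D\<bar> \<le> real ?m powr (3/4)"
      using k k_le[of k] by (intro m0) linarith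
    also have "\<dots> \<le> ?s powr (3/4) + real ?m * ?s powr (-1/4)"
      by (rule powr_three_quarters_le) auto
    also have "real ?m * ?s powr (-1/4) \<le> ((lam + 1) * ?s + \<bar>X k\<bar>) * ?s powr (-1/4)"
    proof (rule mult_right_mono)
      have "real ?m \<le> (lam + 1) * real k + \<bar>X k\<bar>" unfolding X_def by linarith
      also have "(lam + 1) * real k \<le> (lam + 1) * ?s" using lam by (intro mult_left_mono) auto
      finally show "real ?m \<le> (lam + 1) * ?s + \<bar>X k\<bar>" by simp
    qed simp
    also have "\<dots> = (lam + 1) * ?s powr (3/4) + \<bar>X k\<bar> * ?s powr (-1/4)"
    proof -
      have "?s * ?s powr (-1/4) = ?s powr (1 + (-1/4))" by (subst powr_add) simp
      then show ?thesis by (simp add: distrib_right mult.assoc del: of_nat_Suc)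
    qed
    also have "\<bar>X k\<bar> * ?s powr (-1/4) \<le> \<bar>X k\<bar> * 1"
      using powr_mono[of "-1/4" 0 ?s] by (intro mult_left_mono) simp_all
    finally have D: "\<bar>?D\<bar> \<le> (lam + 2) * ?s powr (3/4) + \<bar>X k\<bar>"
      by (simp add: algebra_simps)
    \<comment> \<open>The batch deviation enters twice: directly, and through the expected number p
      M of new nodes.\<close>
    have "w k - \<kappa> * ?s = (1 + \<delta> * p) * X k + \<delta> * ?D + (1 + \<delta> - \<kappa>)"
      by (simp add: w_def weight_def node_count_def X_def \<kappa>_def algebra_simps)
    then have "\<bar>w k - \<kappa> * ?s\<bar> \<le> \<bar>(1 + \<delta> * p) * X k\<bar> + \<bar>\<delta> * ?D\<bar> + C"
      unfolding C_def by linarith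
    also have "\<bar>(1 + \<delta> * p) * X k\<bar> = (1 + \<delta> * p) * \<bar>X k\<bar>"
      using \<delta> p by (simp add: abs_mult)
    also have "\<bar>\<delta> * ?D\<bar> \<le> \<delta> * ((lam + 2) * ?s powr (3/4) + \<bar>X k\<bar>)"
      using \<delta> mult_left_mono[OF D, of \<delta>] by (simp only: abs_mult abs_of_pos)
    finally have "\<bar>w k - \<kappa> * ?s\<bar> \<le> (1 + \<delta> * p + \<delta>) * \<bar>X k\<bar> + \<delta> * (lam + 2) * ?s powr (3/4) + C"
      by (simp add: algebra_simps)
    then have "\<bar>w k - \<kappa> * ?s\<bar> * inverse (?s\<^sup>2)
        \<le> ((1 + \<delta> * p + \<delta>) * \<bar>X k\<bar> + \<delta> * (lam + 2) * ?s powr (3/4) + C) * inverse (?s\<^sup>2)"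
      by (rule mult_right_mono) simp
    also have "\<dots> = (1 + \<delta> * p + \<delta>) * (\<bar>X k\<bar> / ?s\<^sup>2) + \<delta> * (lam + 2) * (?s powr (3/4) * inverse (?s\<^sup>2)) + C * inverse (?s\<^sup>2)"
      by (simp only: distrib_right divide_inverse mult.assoc)
    also have "?s powr (3/4) * inverse (?s\<^sup>2) = ?s powr (-5/4)"
    proof -
      have "inverse (?s\<^sup>2) = ?s powr (-2)" by (simp add: powr_minus)
      then show ?thesis by (simp only: powr_add[symmetric]) simp
    qed
    finally show "norm (\<bar>w k - \<kappa> * ?s\<bar> / ?s\<^sup>2)
        \<le> (1 + \<delta> * p + \<delta>) * (\<bar>X k\<bar> / ?s\<^sup>2) + \<delta> * (lam + 2) * ?s powr (-5/4) + C * inverse (?s\<^sup>2)"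
      by (simp only: real_norm_def divide_inverse abs_mult abs_inverse abs_idempotent abs_power2)
  qed
  from prod_asymp_powr[OF rate_pos \<kappa> w this]
  have "\<exists>L>0. (\<lambda>n. growth n \<omega> / real n powr (rate / \<kappa>)) \<longlonglongrightarrow> L"
    by (simp only: growth_eq w_def)
  moreover have "rate / \<kappa> = growth_exponent"
    using lam by (simp add: rate_def \<kappa>_def growth_exponent_def)
  ultimately show ?case by simp
qed

text \<open>A ratio with a finite positive limit has that limit and its reciprocal as the two upper
  limits.\<close>

lemma as_order_growth: "as_order M growth growth_exponent"
  unfolding as_order_def using AE_growth_asymp
proof eventually_elim
  case (elim \<omega>)
  then obtain L where L: "0 < L" "(\<lambda>n. growth n \<omega> / real n powr growth_exponent) \<longlonglongrightarrow> L" by auto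
  have "(\<lambda>n. real n powr growth_exponent / growth n \<omega>) \<longlonglongrightarrow> inverse L"
    using tendsto_inverse[OF L(2)] L(1) by simp
  then have "limsup (\<lambda>n. ereal (real n powr growth_exponent / growth n \<omega>)) = ereal (inverse L)"
    by (intro lim_imp_Limsup) auto
  moreover have "limsup (\<lambda>n. ereal (growth n \<omega> / real n powr growth_exponent)) = ereal L"
    using L(2) by (intro lim_imp_Limsup) auto
  ultimately show ?case by simp
qed

lemma AE_degree_convergent:
  "AE \<omega> in M. v \<in> nodes B dM i \<omega> \<longrightarrow> convergent (\<lambda>n. real (deg n \<omega> v) / growth n \<omega>)"
  using AE_growth_asymp AE_scaled_convergent[of i v]
proof eventually_elim
  case (elim \<omega>)
  show ?case
  proof
    assume v: "v \<in> nodes B dM i \<omega>"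
    obtain L where L: "0 < L" "(\<lambda>n. growth n \<omega> / real n powr growth_exponent) \<longlonglongrightarrow> L" using elim(1) by auto
    \<comment> \<open>The power of n is written in exponential form; the product is then a positive
      limit times something tending to infinity.\<close>
    have "filterlim (\<lambda>n. exp (growth_exponent * ln (real n))) at_top sequentially"
      by (intro filterlim_compose[OF exp_at_top] filterlim_tendsto_pos_mult_at_top[OF tendsto_const growth_exponent_pos]
          filterlim_compose[OF ln_at_top] filterlim_real_sequentially)
    from filterlim_tendsto_pos_mult_at_top[OF L(2,1) this]
    have "filterlim (\<lambda>n. growth n \<omega> / real n powr growth_exponent * exp (growth_exponent * ln (real n))) at_top sequentially" .
    moreover have "\<forall>\<^sub>F n in sequentially. growth n \<omega> / real n powr growth_exponent * exp (growth_exponent * ln (real n)) = growth n \<omega>"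
      using eventually_gt_at_top[of 0] by eventually_elim (simp add: powr_def)
    ultimately have "filterlim (\<lambda>n. growth n \<omega>) at_top sequentially"
      by (simp cong: filterlim_cong)
    then have "(\<lambda>n. \<delta> / growth n \<omega>) \<longlonglongrightarrow> 0"
      by (intro real_tendsto_divide_at_top[OF tendsto_const])
    then have "(\<lambda>n. \<delta> / growth (n + i) \<omega>) \<longlonglongrightarrow> 0" by (rule LIMSEQ_ignore_initial_segment)
    moreover obtain x where "(\<lambda>n. scaled i v n \<omega>) \<longlonglongrightarrow> x" using elim(2) by (auto simp: convergent_def)
    ultimately have "(\<lambda>n. scaled i v n \<omega> - \<delta> / growth (n + i) \<omega>) \<longlonglongrightarrow> x - 0" by (intro tendsto_diff)
    moreover have "scaled i v n \<omega> - \<delta> / growth (n + i) \<omega> = real (deg (n + i) \<omega> v) / growth (n + i) \<omega>" for n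
      using v by (simp add: scaled_def add.commute[of i] add_divide_distrib)
    ultimately have "(\<lambda>n. real (deg (n + i) \<omega> v) / growth (n + i) \<omega>) \<longlonglongrightarrow> x" by simp
    then have "(\<lambda>n. real (deg n \<omega> v) / growth n \<omega>) \<longlonglongrightarrow> x" by (rule LIMSEQ_offset)
    then show "convergent (\<lambda>n. real (deg n \<omega> v) / growth n \<omega>)" by (auto simp: convergent_def)
  qed
qed

text \<open>\<open>lim\<close> is total and measurable as a limit of measurable functions, so it
  serves as the random variable even where v is absent; convergence is used only on the event that v
  is new at step i.\<close>

lemma degree_limit:
  "\<exists>\<xi> \<in> borel_measurable M. AE \<omega> in M. v \<in> new_nodes B dM i \<omega> \<longrightarrow>
     (\<lambda>n. real (deg n \<omega> v) / growth n \<omega>) \<longlonglongrightarrow> (\<xi> \<omega> :: real)"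
proof (rule bexI)
  note [measurable] = growth_measurable
  show "(\<lambda>\<omega>. lim (\<lambda>n. real (deg n \<omega> v) / growth n \<omega>)) \<in> borel_measurable M"
    by (rule borel_measurable_lim_metric) measurable
  show "AE \<omega> in M. v \<in> new_nodes B dM i \<omega> \<longrightarrow>
      (\<lambda>n. real (deg n \<omega> v) / growth n \<omega>) \<longlonglongrightarrow> lim (\<lambda>n. real (deg n \<omega> v) / growth n \<omega>)"
    using AE_degree_convergent[of v i]
    by eventually_elim (simp only: new_nodes_def Diff_iff convergent_LIMSEQ_iff, blast)
qed

end

theorem proposition4p1:
  fixes M :: "'a measure"
    and p \<delta>_in \<delta>_out lam :: real
    and B dM :: "nat \<Rightarrow> 'a \<Rightarrow> nat"
    and \<tau> \<tau>' :: "nat \<Rightarrow> nat \<Rightarrow> 'a \<Rightarrow> real"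
  assumes "0 < p" and "p < 1" and "\<delta>_in > 0" and "\<delta>_out > 0" and "lam > 0"
    and "pa_driving M p lam B \<tau> \<tau>' dM"
  shows "(\<forall>i v. \<exists>\<xi> \<in> borel_measurable M. \<exists>\<xi>' \<in> borel_measurable M.
           (AE \<omega> in M. v \<in> new_nodes B dM i \<omega> \<longrightarrow>
             (\<lambda>n. real (in_degree \<delta>_in \<tau> B dM n \<omega> v) / norm_prod (lam + 1) \<delta>_in B dM n \<omega>)
               \<longlonglongrightarrow> (\<xi> \<omega> :: real)) \<and>
           (AE \<omega> in M. v \<in> new_nodes B dM i \<omega> \<longrightarrow>
             (\<lambda>n. real (out_degree \<delta>_out \<tau>' B dM n \<omega> v) /
                  norm_prod ((lam + 1) * (1 - p)) \<delta>_out B dM n \<omega>)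
               \<longlonglongrightarrow> (\<xi>' \<omega> :: real)))
       \<and> as_order M (norm_prod (lam + 1) \<delta>_in B dM) (1 / (1 + \<delta>_in * p))
       \<and> as_order M (norm_prod ((lam + 1) * (1 - p)) \<delta>_out B dM) ((1 - p) / (1 + \<delta>_out * p))"
proof -
  interpret pa_driving M p lam B \<tau> \<tau>' dM by fact
  \<comment> \<open>With \<theta> = 0 the factor 1 - \<theta> p is 1, with \<theta> = 1 it is 1 - p;
    this accounts for the two rates and the two exponents.\<close>
  interpret I: pa_degree_process M p lam B \<tau> \<tau>' dM 0 \<delta>_in In_Clock
    using assms by unfold_locales auto
  interpret O: pa_degree_process M p lam B \<tau> \<tau>' dM 1 \<delta>_out Out_Clock
    using assms by unfold_locales auto
  have clocks: "I.T = \<tau>" "O.T = \<tau>'"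
    by (simp_all add: fun_eq_iff src_def)
  have rates: "I.rate = lam + 1" "O.rate = (lam + 1) * (1 - p)"
    unfolding I.rate_def O.rate_def by simp_all
  have expos: "I.growth_exponent = 1 / (1 + \<delta>_in * p)" "O.growth_exponent = (1 - p) / (1 + \<delta>_out * p)"
    unfolding I.growth_exponent_def O.growth_exponent_def by simp_all
  have "\<exists>\<xi> \<in> borel_measurable M. \<exists>\<xi>' \<in> borel_measurable M.
           (AE \<omega> in M. v \<in> new_nodes B dM i \<omega> \<longrightarrow>
             (\<lambda>n. real (in_degree \<delta>_in \<tau> B dM n \<omega> v) / norm_prod (lam + 1) \<delta>_in B dM n \<omega>)
               \<longlonglongrightarrow> (\<xi> \<omega> :: real)) \<and>
           (AE \<omega> in M. v \<in> new_nodes B dM i \<omega> \<longrightarrow>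
             (\<lambda>n. real (out_degree \<delta>_out \<tau>' B dM n \<omega> v) /
                  norm_prod ((lam + 1) * (1 - p)) \<delta>_out B dM n \<omega>)
               \<longlonglongrightarrow> (\<xi>' \<omega> :: real))" for i v
    using I.degree_limit[of v i] O.degree_limit[of v i]
    unfolding in_degree_eq out_degree_eq clocks rates by blast
  then show ?thesis
    using I.as_order_growth O.as_order_growth unfolding rates expos by blast
qed

end
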